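(* Let $P_i\succ0$ ($n\times n$), $\alpha_i\ge0$, $L_i\in\mathbb R^{m\times n}$, $Y_i\succ0$ ($n\times n$) for $i\in\mathcal I$ and $\Pi=[\pi_{i,j}]\in\mathcal M_+$ satisfy, for all $i\in\mathcal I$, $$\begin{bmatrix}\boldsymbol\pi_{-i}^{-1}\boldsymbol P_{-i}^{-1}&(\mathbf 1_{N-1}\otimes I_n)P_i^{-1}&0&0 \\ P_i^{-1}(\mathbf 1_{N-1}\otimes I_n)^\top&-\pi_{i,i}P_i^{-1}-Y_i&-P_i^{-1}&-L_i^\top \\ 0&-P_i^{-1}&0&0 \\ 0&-L_i&0&0\end{bmatrix}-\alpha_i\,\Gamma_i\,\Phi^i\,\Gamma_i^\top\succcurlyeq0,\qquad\Gamma_i:=\begin{bmatrix} 0&0 \\ I&\dot X_i \\ 0&-X_i \\ 0&-U_i\end{bmatrix},$$ $$\begin{bmatrix} I&C_iP_i^{-1}+D_iL_i \\ (C_iP_i^{-1}+D_iL_i)^\top&Y_i\end{bmatrix}\succ0 .$$ Then the controller $$\sigma(x)=\min\{\operatorname{argmin}_{i\in\mathcal I}x^\top P_ix\},\qquad u(x)=K_{\sigma(x)}x,\qquad K_i:=L_iP_i,$$ globally asymptotically stabilizes the switched system $\dot x=\bar A_\sigma x+\bar B_\sigma u+E_\sigma\psi$, $z=C_\sigma x+D_\sigma u+F_\sigma\psi$. Furthermore, if $E_i=E$ for all $i\in\mathcal I$ (and $F_i=0$ for all $i\in\mathcal I$, as required for $J_2$ to be defined), then the closed-loop system satisfies $$J_2(\sigma,u)<\min_{i\in\mathcal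 I}\operatorname{tr}(E^\top P_iE).$$
   Context: Let $\mathcal I=\{1,\dots,N\}$. For each $i\in\mathcal I$: true (unknown) matrices $\bar A_i\in\mathbb R^{n\times n}$, $\bar B_i\in\mathbb R^{n\times m}$; known matrices $C_i\in\mathbb R^{p\times n}$, $D_i\in\mathbb R^{p\times m}$, $E_i\in\mathbb R^{n\times q}$, $F_i\in\mathbb R^{p\times q}$; data matrices $X_i,\dot X_i\in\mathbb R^{n\times T_i}$, $U_i\in\mathbb R^{m\times T_i}$ (here $\dot X_i$ is just a name) satisfying $\dot X_i=\bar A_iX_i+\bar B_iU_i+\bar W_i$ for an unknown $\bar W_i\in\mathcal W_i$, where $$\mathcal W_i:=\Big\{W\in\mathbb R^{n\times T_i}\ \Big|\ \begin{bmatrix} I \\ W^\top\end{bmatrix}^\top\Phi^i\begin{bmatrix} I \\ W^\top\end{bmatrix}\succcurlyeq 0\Big\},\qquad \Phi^i=\begin{bmatrix}\Phi^i_{1,1}&\Phi^i_{1,2} \\ {\Phi^i_{1,2}}^\top&\Phi^i_{2,2}\end{bmatrix}$$ with known symmetric $\Phi^i$ and $\Phi^i_{2,2}\prec0$ ($\Phi^i_{1,1}$ is $n\times n$, $\Phi^i_{2,2}$ is $T_i\times T_i$). $\mathcal M_+:=\{\Pi\in\mathbb R^{N\times N}\mid \pi_{i,j}>0\ \forall i\ne j,\ \sum_{i=1}^N\pi_{i,j}=0\ \forall j\}$. $\boldsymbol P_{-i}:=\mathrm{diag}((P_j)_{j\in\mathcal I\setminus\{i\}})$, $\boldsymbol\pi_{-i}:=\mathrm{diag}((\pi_{j,i}I_n)_{j\in\mathcal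 I\setminus\{i\}})$ (block diagonal, same ordering); $\mathbf 1_{N-1}$ is the all-ones vector. The row blocks of $\Gamma_i$ have heights $(N-1)n,n,n,m$ and its column blocks have widths $n,T_i$. Solution concept. Given a disturbance $\psi:\mathbb R_{\ge0}\to\mathbb R^q$, put $\xi_i(x,t):=(\bar A_i+\bar B_iK_i)x+E_i\psi(t)$, $\mathcal X_i:=\{x\in\mathbb R^n\mid\sigma(x)=i\}$, $\mathrm I(x):=\{i\in\mathcal I\mid$ every neighborhood of $x$ meets $\mathcal X_i\}$, $\dot v_i(x,\xi):=x^\top P_i\xi+\xi^\top P_ix$. A solution of the closed loop is an absolutely continuous $x:\mathbb R_{\ge0}\to\mathbb R^n$ such that, for almost all $t$, with $x=x(t)$, $$\dot x(t)=\sum_{i\in\mathrm I(x)}a_i(x)\xi_i(x,t)\quad\text{and}\quad \dot v_{\sigma(x)}\Big(x,\sum_{i\in\mathrm I(x)}a_i(x)\xi_i(x,t)\Big)\le\sum_{i\in\mathrm I(x)}\dot v_i(x,a_i(x)\xi_i(x,t))$$ for some weights $a_i(x)\ge0$ ($i\in\mathrm I(x)$) with $\sum_{i\in\mathrm I(x)}a_i(x)=1$; the weights are taken, without loss of generality, such that $t\mapsto a_i(x(t))$ is almost everywhere continuous. Existence of solutions in this sense is assumed wherever needed. Global asymptotic stability refers to the origin and to $\psi\equiv0$. $\mathcal H_2$ index (for $F_i=0$, $E_i=E$ for all $i$). The modified output is $z_a:=\sum_{i\in\mathrm I(x)}a_i(x)z_i$ with $z_i:=(C_i+D_iK_i)x+F_i\psi$.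 For $k=1,\dots,q$ let $z_a^k$ be the modified output along a solution generated, from rest, by the impulsive disturbance $\psi(t)=e_k\delta(t)$, i.e. a solution with zero disturbance and $x(0)=Ee_k$, where $e_k$ is the $k$-th standard basis vector of $\mathbb R^q$. Then $J_2:=\sum_{k=1}^q\|z_a^k\|_2^2$, with $\|s\|_2^2=\int_0^\infty s(t)^\top s(t)\,dt$.
   Formalization: The bound on J_2 is proved under the added assumption E ≠ 0; for E = 0 all impulse responses stay at 0, so J_2 = 0 = tr(EᵀP_iE) and the strict inequality fails. *)

theory Defs
  imports "HOL-Analysis.Analysis"
begin

text \<open>
  The widths \<open>T i\<close> of the data matrices and the height \<open>(N - 1) n\<close> of a block depend on the mode,
  so they cannot be type-level dimensions. Matrices having such a dimension are functions
  \<open>'r \<Rightarrow> 'c \<Rightarrow> real\<close>, of which only the entries on explicitly given finite index sets matter;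
  a sum type indexes the concatenation of blocks. All other matrices have type \<open>real^'c^'r\<close>.
\<close>

type_synonym ('r, 'c) imat = "'r \<Rightarrow> 'c \<Rightarrow> real"

definition ent :: "real^'c^'r \<Rightarrow> ('r, 'c) imat" where
  "ent M = (\<lambda>r c. M $ r $ c)"

definition imat_id :: "('a, 'a) imat" where
  "imat_id = (\<lambda>r c. if r = c then 1 else 0)"

definition imat_zero :: "('r, 'c) imat" where
  "imat_zero = (\<lambda>r c. 0)"

definition imat_minus :: "('r, 'c) imat \<Rightarrow> ('r, 'c) imat" where
  "imat_minus M = (\<lambda>r c. - M r c)"

definition imat_transpose :: "('r, 'c) imat \<Rightarrow> ('c, 'r) imat" where
  "imat_transpose M = (\<lambda>r c. M c r)"

definition imat_mult :: "'k set \<Rightarrow> ('r, 'k) imat \<Rightarrow> ('k, 'c) imat \<Rightarrow> ('r, 'c) imat" where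
  "imat_mult S A B = (\<lambda>r c. \<Sum>k\<in>S. A r k * B k c)"

definition imat_inv :: "'a set \<Rightarrow> ('a, 'a) imat \<Rightarrow> ('a, 'a) imat" where
  "imat_inv S M = (SOME B. \<forall>r\<in>S. \<forall>c\<in>S.
      imat_mult S M B r c = imat_id r c \<and> imat_mult S B M r c = imat_id r c)"

definition hcat :: "('r, 'c) imat \<Rightarrow> ('r, 'd) imat \<Rightarrow> ('r, 'c + 'd) imat"  (infixr \<open>hcat\<close> 67) where
  "A hcat B = (\<lambda>r. case_sum (A r) (B r))"

definition vcat :: "('r, 'c) imat \<Rightarrow> ('s, 'c) imat \<Rightarrow> ('r + 's, 'c) imat"  (infixr \<open>vcat\<close> 66) where
  "A vcat B = case_sum A B"

definition block_diag :: "('j \<Rightarrow> real^'n^'n) \<Rightarrow> ('j \<times> 'n, 'j \<times> 'n) imat" where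
  "block_diag M = (\<lambda>(j, a) (l, b). if j = l then M j $ a $ b else 0)"

text \<open>\<open>\<one> \<otimes> I\<close>, a column of identity blocks.\<close>

definition ones_kron_id :: "('j \<times> 'n, 'n) imat" where
  "ones_kron_id = (\<lambda>(j, a) b. imat_id a b)"

definition symmetric_on :: "'a set \<Rightarrow> ('a, 'a) imat \<Rightarrow> bool" where
  "symmetric_on S M \<longleftrightarrow> (\<forall>r\<in>S. \<forall>c\<in>S. M r c = M c r)"

definition pos_semidef_on :: "'a set \<Rightarrow> ('a, 'a) imat \<Rightarrow> bool" where
  "pos_semidef_on S M \<longleftrightarrow> symmetric_on S M \<and>
     (\<forall>v :: 'a \<Rightarrow> real. 0 \<le> (\<Sum>r\<in>S. \<Sum>c\<in>S. v r * M r c * v c))"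

definition pos_def_on :: "'a set \<Rightarrow> ('a, 'a) imat \<Rightarrow> bool" where
  "pos_def_on S M \<longleftrightarrow> symmetric_on S M \<and>
     (\<forall>v :: 'a \<Rightarrow> real. (\<exists>r\<in>S. v r \<noteq> 0) \<longrightarrow> 0 < (\<Sum>r\<in>S. \<Sum>c\<in>S. v r * M r c * v c))"

definition pos_def :: "real^'n^'n \<Rightarrow> bool" where
  "pos_def M \<longleftrightarrow> pos_def_on UNIV (ent M)"

text \<open>Index set of \<open>\<Phi>\<close> with blocks of size \<open>n\<close> and \<open>T\<close>.\<close>

definition data_index :: "nat \<Rightarrow> ('n::finite + nat) set" where
  "data_index T = UNIV <+> {..<T}"

definition noise_set :: "nat \<Rightarrow> ('n + nat, 'n + nat) imat \<Rightarrow> ('n::finite, nat) imat set" where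
  "noise_set T \<Phi> = {W. pos_semidef_on UNIV
      (imat_mult (data_index T)
        (imat_mult (data_index T) (imat_transpose (imat_id vcat imat_transpose W)) \<Phi>)
        (imat_id vcat imat_transpose W))}"

definition metzler_plus :: "nat \<Rightarrow> (nat \<Rightarrow> nat \<Rightarrow> real) set" where
  "metzler_plus N = {\<pi>. (\<forall>i\<in>{1..N}. \<forall>j\<in>{1..N}. i \<noteq> j \<longrightarrow> 0 < \<pi> i j) \<and>
                        (\<forall>j\<in>{1..N}. (\<Sum>i\<in>{1..N}. \<pi> i j) = 0)}"

definition other_modes_index :: "nat \<Rightarrow> nat \<Rightarrow> (nat \<times> 'n::finite) set" where
  "other_modes_index N i = ({1..N} - {i}) \<times> UNIV"

definition lmi_index ::
  "nat \<Rightarrow> nat \<Rightarrow> ((nat \<times> 'n::finite) + 'n + 'n + 'm::finite) set" where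
  "lmi_index N i = other_modes_index N i <+> UNIV <+> UNIV <+> UNIV"

definition lmi_block ::
  "nat \<Rightarrow> (nat \<Rightarrow> nat \<Rightarrow> real) \<Rightarrow> (nat \<Rightarrow> real^'n^'n) \<Rightarrow> real^'n^'m \<Rightarrow> real^'n^'n \<Rightarrow> nat
    \<Rightarrow> ((nat \<times> 'n::finite) + 'n + 'n + 'm::finite, (nat \<times> 'n) + 'n + 'n + 'm) imat" where
  "lmi_block N \<pi> P L Y i =
    (let S = other_modes_index N i;
         Q = matrix_inv (P i);
         R = imat_mult S (imat_inv S (block_diag (\<lambda>j. mat (\<pi> j i)))) (imat_inv S (block_diag P));
         G = imat_mult UNIV ones_kron_id (ent Q)
     in
      (R                 hcat G                            hcat imat_zero  hcat imat_zero) vcat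
      (imat_mult UNIV (ent Q) (imat_transpose ones_kron_id)
                         hcat ent (- (\<pi> i i *\<^sub>R Q) - Y) hcat ent (- Q)  hcat ent (- transpose L)) vcat
      (imat_zero         hcat ent (- Q)                    hcat imat_zero  hcat imat_zero) vcat
      (imat_zero         hcat ent (- L)                    hcat imat_zero  hcat imat_zero))"

definition Gamma_block ::
  "('n, nat) imat \<Rightarrow> ('n, nat) imat \<Rightarrow> ('m, nat) imat
    \<Rightarrow> ((nat \<times> 'n) + 'n + 'n + 'm, 'n + nat) imat" where
  "Gamma_block Xd X U =
      (imat_zero hcat imat_zero) vcat
      (imat_id   hcat Xd) vcat
      (imat_zero hcat imat_minus X) vcat
      (imat_zero hcat imat_minus U)"

definition perf_block ::
  "real^'n^'p \<Rightarrow> real^'m^'p \<Rightarrow> real^'n^'n \<Rightarrow> real^'n^'m \<Rightarrow> real^'n^'n \<Rightarrow> ('p + 'n, 'p + 'n) imat" where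
  "perf_block C D P L Y =
    (let H = C ** matrix_inv P + D ** L in
      (imat_id hcat ent H) vcat
      (ent (transpose H) hcat ent Y))"

definition switch :: "nat \<Rightarrow> (nat \<Rightarrow> real^'n^'n) \<Rightarrow> real^'n \<Rightarrow> nat" where
  "switch N P x = Min {i. is_arg_min (\<lambda>i. x \<bullet> (P i *v x)) (\<lambda>i. i \<in> {1..N}) i}"

definition active :: "nat \<Rightarrow> (nat \<Rightarrow> real^'n^'n) \<Rightarrow> real^'n \<Rightarrow> nat set" where
  "active N P x = {i \<in> {1..N}. x \<in> closure {y. switch N P y = i}}"

definition vdot :: "real^'n^'n \<Rightarrow> real^'n \<Rightarrow> real^'n \<Rightarrow> real" where
  "vdot P x \<xi> = x \<bullet> (P *v \<xi>) + \<xi> \<bullet> (P *v x)"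

definition mode_field ::
  "(nat \<Rightarrow> real^'n^'n) \<Rightarrow> (nat \<Rightarrow> real^'m^'n) \<Rightarrow> (nat \<Rightarrow> real^'q^'n) \<Rightarrow> (nat \<Rightarrow> real^'n^'m)
    \<Rightarrow> (real \<Rightarrow> real^'q) \<Rightarrow> nat \<Rightarrow> real^'n \<Rightarrow> real \<Rightarrow> real^'n" where
  "mode_field A B E K \<psi> i x t = (A i + B i ** K i) *v x + E i *v \<psi> t"

definition abs_continuous_on :: "real set \<Rightarrow> (real \<Rightarrow> 'a::real_normed_vector) \<Rightarrow> bool" where
  "abs_continuous_on S f \<longleftrightarrow>
    (\<forall>\<epsilon>>0. \<exists>\<delta>>0. \<forall>D. D division_of \<Union>D \<and> \<Union>D \<subseteq> S \<and> (\<Sum>k\<in>D. Sup k - Inf k) < \<delta>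
        \<longrightarrow> (\<Sum>k\<in>D. norm (f (Sup k) - f (Inf k))) < \<epsilon>)"

text \<open>
  \<open>a i t\<close> is the weight written \<open>a\<^sub>i(x(t))\<close>; it is meaningful when \<open>i\<close> is active at \<open>x t\<close>, so its
  almost everywhere continuity is relative to the set of those times.
\<close>

definition closed_loop_solution ::
  "nat \<Rightarrow> (nat \<Rightarrow> real^'n^'n) \<Rightarrow> (nat \<Rightarrow> real^'n^'n) \<Rightarrow> (nat \<Rightarrow> real^'m^'n) \<Rightarrow> (nat \<Rightarrow> real^'q^'n)
    \<Rightarrow> (nat \<Rightarrow> real^'n^'m) \<Rightarrow> (real \<Rightarrow> real^'q)
    \<Rightarrow> (real \<Rightarrow> real^'n) \<Rightarrow> (nat \<Rightarrow> real \<Rightarrow> real) \<Rightarrow> bool" where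
  "closed_loop_solution N P A B E K \<psi> x a \<longleftrightarrow>
    (\<forall>b\<ge>0. abs_continuous_on {0..b} x) \<and>
    (AE t in lebesgue. 0 \<le> t \<longrightarrow>
      (\<forall>i\<in>active N P (x t). 0 \<le> a i t) \<and>
      (\<Sum>i\<in>active N P (x t). a i t) = 1 \<and>
      (x has_vector_derivative
        (\<Sum>i\<in>active N P (x t). a i t *\<^sub>R mode_field A B E K \<psi> i (x t) t)) (at t) \<and>
      vdot (P (switch N P (x t))) (x t)
        (\<Sum>i\<in>active N P (x t). a i t *\<^sub>R mode_field A B E K \<psi> i (x t) t)
      \<le> (\<Sum>i\<in>active N P (x t). vdot (P i) (x t) (a i t *\<^sub>R mode_field A B E K \<psi> i (x t) t))) \<and>
    (\<forall>i\<in>{1..N}. AE t in lebesgue. 0 \<le> t \<and> i \<in> active N P (x t) \<longrightarrow>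
      continuous (at t within {s. 0 \<le> s \<and> i \<in> active N P (x s)}) (a i))"

definition globally_asymptotically_stable :: "(real \<Rightarrow> 'a::real_normed_vector) set \<Rightarrow> bool" where
  "globally_asymptotically_stable Sol \<longleftrightarrow>
    (\<forall>\<epsilon>>0. \<exists>\<delta>>0. \<forall>x\<in>Sol. norm (x 0) < \<delta> \<longrightarrow> (\<forall>t\<ge>0. norm (x t) < \<epsilon>)) \<and>
    (\<forall>x\<in>Sol. (x \<longlongrightarrow> 0) at_top)"

definition modified_output ::
  "nat \<Rightarrow> (nat \<Rightarrow> real^'n^'n) \<Rightarrow> (nat \<Rightarrow> real^'n^'p) \<Rightarrow> (nat \<Rightarrow> real^'m^'p) \<Rightarrow> (nat \<Rightarrow> real^'q^'p)
    \<Rightarrow> (nat \<Rightarrow> real^'n^'m) \<Rightarrow> (real \<Rightarrow> real^'q)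
    \<Rightarrow> (real \<Rightarrow> real^'n) \<Rightarrow> (nat \<Rightarrow> real \<Rightarrow> real) \<Rightarrow> real \<Rightarrow> real^'p" where
  "modified_output N P C D F K \<psi> x a t =
    (\<Sum>i\<in>active N P (x t). a i t *\<^sub>R ((C i + D i ** K i) *v x t + F i *v \<psi> t))"

text \<open>Extended nonnegative, so that a bound includes finiteness of the integral.\<close>

definition l2_norm_sq :: "(real \<Rightarrow> real^'p) \<Rightarrow> ennreal" where
  "l2_norm_sq s = (\<integral>\<^sup>+ t\<in>{0..}. ennreal (s t \<bullet> s t) \<partial>lebesgue)"

text \<open>
  \<open>xs k\<close>, \<open>as k\<close> are the trajectory and the weights for the impulse in the \<open>k\<close>-th input channel.
\<close>

definition impulse_response_family ::
  "nat \<Rightarrow> (nat \<Rightarrow> real^'n^'n) \<Rightarrow> (nat \<Rightarrow> real^'n^'n) \<Rightarrow> (nat \<Rightarrow> real^'m^'n) \<Rightarrow> real^'q^'n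
    \<Rightarrow> (nat \<Rightarrow> real^'n^'m) \<Rightarrow> ('q \<Rightarrow> real \<Rightarrow> real^'n) \<Rightarrow> ('q \<Rightarrow> nat \<Rightarrow> real \<Rightarrow> real) \<Rightarrow> bool" where
  "impulse_response_family N P A B E K xs as \<longleftrightarrow>
    (\<forall>k. closed_loop_solution N P A B (\<lambda>_. E) K (\<lambda>_. 0) (xs k) (as k) \<and> xs k 0 = E *v axis k 1)"

definition J2 ::
  "nat \<Rightarrow> (nat \<Rightarrow> real^'n^'n) \<Rightarrow> (nat \<Rightarrow> real^'n^'p) \<Rightarrow> (nat \<Rightarrow> real^'m^'p) \<Rightarrow> (nat \<Rightarrow> real^'q^'p)
    \<Rightarrow> (nat \<Rightarrow> real^'n^'m) \<Rightarrow> ('q \<Rightarrow> real \<Rightarrow> real^'n) \<Rightarrow> ('q \<Rightarrow> nat \<Rightarrow> real \<Rightarrow> real) \<Rightarrow> ennreal" where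
  "J2 N P C D F K xs as =
    (\<Sum>k\<in>UNIV. l2_norm_sq (modified_output N P C D F K (\<lambda>_. 0) (xs k) (as k)))"

end

theory Submission
  imports Defs
begin

text \<open>
  The data LMI, tested on suitable vectors, yields the Lyapunov--Metzler inequalities
  \<open>M\<^sub>i\<^sup>T P\<^sub>i + P\<^sub>i M\<^sub>i + \<Sum>\<^sub>j \<pi>\<^sub>j\<^sub>i P\<^sub>j + Z\<^sub>i\<^sup>T Z\<^sub>i \<prec> 0\<close> with \<open>M\<^sub>i = A\<^sub>i + B\<^sub>i K\<^sub>i\<close> and
  \<open>Z\<^sub>i = C\<^sub>i + D\<^sub>i K\<^sub>i\<close>. Every active mode at \<open>x\<close> minimises \<open>x\<^sup>T P\<^sub>i x\<close>, so the Metzler term is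
  nonnegative there, and along solutions \<open>V x = min\<^sub>i x\<^sup>T P\<^sub>i x\<close> decreases at least at the rate
  \<open>c \<bar>x\<bar>\<^sup>2 + \<bar>z\<^sub>a\<bar>\<^sup>2\<close> almost everywhere. Since \<open>V\<close> is absolutely continuous along solutions, this
  integrates to asymptotic stability and to the strict bound on the output energy.
\<close>

subsection \<open>Absolutely continuous functions and pointwise minima\<close>

text \<open>The data LMI is only semidefinite, so all strictness comes from the second LMI. It makes
  the Lyapunov--Metzler form negative at every nonzero \<open>x\<close>, and compactness of the unit
  sphere turns this into the margin \<open>c\<close>. The margin acts twice: it forces convergence,
  and its integral over the first unit of time, from a nonzero initial state, is the gap in the
  bound on \<open>J2\<close>. For \<open>E0 = 0\<close> both sides of that bound would be 0, so the
  strict claim is made for \<open>E0 \<noteq> 0\<close>.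

  The LMIs control form \<open>i\<close> only along field \<open>i\<close>, whereas a sliding
  trajectory follows a convex combination of fields and may sit where several forms tie. Two facts
  bridge this: at almost every time all tied forms have the same derivative, namely that of the
  minimum, and the inequality in the solution concept bounds the derivative of the selected form by
  the weighted sum of the derivatives of the forms along their own fields. Convexity of the squared
  norm makes the matching step for the output.\<close>

lemma countable_isolated_points:
  fixes S :: "'a::second_countable_topology set"
  shows "countable {t. t isolated_in S}"
proof -
  obtain \<B> :: "'a set set" where \<B>: "countable \<B>" "\<And>U. open U \<Longrightarrow> \<exists>V. V \<subseteq> \<B> \<and> U = \<Union>V"
    using univ_second_countable by metis
  \<comment> \<open>A basic open set meeting \<open>S\<close> only in \<open>t\<close> determines
    \<open>t\<close>, so choosing one for each isolated point injects these points into the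
    countable basis.\<close>
  have "\<exists>V\<in>\<B>. V \<inter> S = {t}" if t: "t isolated_in S" for t
  proof -
    obtain T where T: "open T" "T \<inter> S = {t}" "t \<in> S"
      using t unfolding isolated_in_def by blast
    then obtain \<V> where "\<V> \<subseteq> \<B>" "T = \<Union>\<V>" using \<B>(2) by blast
    with T show ?thesis by blast
  qed
  then obtain b where b: "\<And>t. t isolated_in S \<Longrightarrow> b t \<in> \<B> \<and> b t \<inter> S = {t}" by metis
  have "inj_on b {t. t isolated_in S}"
    by (rule inj_onI) (metis b mem_Collect_eq singleton_inject)
  moreover have "b ` {t. t isolated_in S} \<subseteq> \<B>" using b by auto
  ultimately show ?thesis
    using \<B>(1) countable_image_inj_on countable_subset by blast
qed

text \<open>The difference quotient at \<open>t\<close> tends to \<open>d\<close>, hence is nonzero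
  near \<open>t\<close>, while at a further zero of \<open>f\<close> it would vanish.\<close>

lemma isolated_in_zero_set_of_derivative_neq_0:
  fixes f :: "real \<Rightarrow> real"
  assumes "(f has_real_derivative d) (at t)" "d \<noteq> 0" "f t = 0"
  shows "t isolated_in {s. f s = 0}"
proof -
  have "((\<lambda>s. (f s - f t) / (s - t)) \<longlongrightarrow> d) (at t)"
    using assms(1) by (simp add: has_field_derivative_iff)
  then have "eventually (\<lambda>s. (f s - f t) / (s - t) \<noteq> 0) (at t)"
    using assms(2) by (rule tendsto_imp_eventually_ne)
  then have "eventually (\<lambda>s. s \<notin> {s. f s = 0}) (at t)"
    by eventually_elim (use assms(3) in auto)
  then show ?thesis using assms(3) by (simp add: isolated_in_altdef)
qed

text \<open>Two functions that agree at a point with different derivatives there agree nowhere nearby, so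
  the minimum fails to be differentiable only at isolated points of coincidence sets.\<close>

lemma Min_has_real_derivative_off_countable:
  fixes g :: "'i \<Rightarrow> real \<Rightarrow> real"
  assumes "finite I" "I \<noteq> {}"
  obtains S where "countable S"
    "\<And>t g' i. t \<notin> S \<Longrightarrow> (\<And>j. j \<in> I \<Longrightarrow> (g j has_real_derivative g' j) (at t)) \<Longrightarrow> i \<in> I \<Longrightarrow>
       (\<And>j. j \<in> I \<Longrightarrow> g i t \<le> g j t) \<Longrightarrow>
       ((\<lambda>s. Min ((\<lambda>j. g j s) ` I)) has_real_derivative g' i) (at t)"
proof
  let ?S = "\<Union>i\<in>I. \<Union>j\<in>I. {t. t isolated_in {s. g i s - g j s = 0}}"
  show "countable ?S"
    using assms by (intro countable_UN countable_finite countable_isolated_points) auto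
  fix t g' i
  assume t: "t \<notin> ?S" and g': "\<And>j. j \<in> I \<Longrightarrow> (g j has_real_derivative g' j) (at t)"
    and i: "i \<in> I" and min: "\<And>j. j \<in> I \<Longrightarrow> g i t \<le> g j t"
  let ?f = "\<lambda>s. Min ((\<lambda>j. g j s) ` I)"
  define J where "J = {j \<in> I. g j t = g i t}"
  have ft: "?f t = g i t"
    using assms i min by (intro Min_eqI) auto
  \<comment> \<open>All forms tied at \<open>t\<close> share one derivative: with different ones
    \<open>t\<close> would be an isolated coincidence, and these were put into the exceptional
    set.\<close>
  have g'J: "g' j = g' i" if "j \<in> J" for j
  proof (rule ccontr)
    assume "g' j \<noteq> g' i"
    moreover have "((\<lambda>s. g i s - g j s) has_real_derivative g' i - g' j) (at t)"
      using that i g' by (auto intro!: derivative_intros simp: J_def)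
    ultimately have "t isolated_in {s. g i s - g j s = 0}"
      using that by (intro isolated_in_zero_set_of_derivative_neq_0) (auto simp: J_def)
    with t i that show False unfolding J_def by blast
  qed
  \<comment> \<open>By continuity the functions above the minimum at \<open>t\<close> stay above
    \<open>g i\<close> nearby, so each difference quotient of the minimum close to \<open>t\<close>
    is that of some member of \<open>J\<close>.\<close>
  have ev1: "\<forall>\<^sub>F s in at t. \<forall>j\<in>I - J. g i s < g j s"
  proof (rule eventually_ball_finite)
    show "\<forall>j\<in>I - J. \<forall>\<^sub>F s in at t. g i s < g j s"
    proof
      fix j assume j: "j \<in> I - J"
      have "(g i \<longlongrightarrow> g i t) (at t)" "(g j \<longlongrightarrow> g j t) (at t)"
        using g' i j DERIV_isCont isContD by blast+
      moreover have "g i t < g j t" using min[of j] j unfolding J_def by force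
      ultimately show "\<forall>\<^sub>F s in at t. g i s < g j s"
        by (rule order_tendstoD(2)[OF tendsto_diff[of "g i" _ _ "g j"], of _ _ _ 0, simplified])
    qed
  qed (use assms in auto)
  have "((\<lambda>s. (?f s - ?f t) / (s - t)) \<longlongrightarrow> g' i) (at t)"
  proof (rule tendstoI)
    fix e :: real assume e: "0 < e"
    have "\<forall>\<^sub>F s in at t. \<forall>j\<in>J. dist ((g j s - g j t) / (s - t)) (g' i) < e"
    proof (rule eventually_ball_finite)
      show "\<forall>j\<in>J. \<forall>\<^sub>F s in at t. dist ((g j s - g j t) / (s - t)) (g' i) < e"
      proof
        fix j assume j: "j \<in> J"
        then have "((\<lambda>s. (g j s - g j t) / (s - t)) \<longlongrightarrow> g' i) (at t)"
          using g'[of j] g'J[OF j] by (simp add: has_field_derivative_iff J_def)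
        then show "\<forall>\<^sub>F s in at t. dist ((g j s - g j t) / (s - t)) (g' i) < e"
          using e by (rule tendstoD)
      qed
    qed (use assms J_def in auto)
    with ev1 show "\<forall>\<^sub>F s in at t. dist ((?f s - ?f t) / (s - t)) (g' i) < e"
    proof eventually_elim
      case (elim s)
      have "?f s \<in> (\<lambda>j. g j s) ` I" using assms by (intro Min_in) auto
      then obtain j where j: "j \<in> I" "?f s = g j s" by auto
      have "?f s \<le> g i s" using assms i by auto
      with elim(1) j have "j \<in> J" by (metis DiffI not_le)
      with elim(2) j ft show ?case by (auto simp: J_def)
    qed
  qed
  then show "(?f has_real_derivative g' i) (at t)"
    by (simp add: has_field_derivative_iff)
qed

section \<open>Absolute continuity and integration of derivative bounds that hold almost
  everywhere\<close>

lemma abs_continuous_onE: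
  assumes "abs_continuous_on S f" "0 < \<epsilon>"
  obtains \<delta> where "0 < \<delta>"
    "\<And>D. D division_of \<Union>D \<Longrightarrow> \<Union>D \<subseteq> S \<Longrightarrow> (\<Sum>k\<in>D. Sup k - Inf k) < \<delta> \<Longrightarrow>
        (\<Sum>k\<in>D. norm (f (Sup k) - f (Inf k))) < \<epsilon>"
proof -
  from assms obtain \<delta> where "0 < \<delta>"
    and \<delta>: "\<forall>D. D division_of \<Union>D \<and> \<Union>D \<subseteq> S \<and> (\<Sum>k\<in>D. Sup k - Inf k) < \<delta>
        \<longrightarrow> (\<Sum>k\<in>D. norm (f (Sup k) - f (Inf k))) < \<epsilon>"
    unfolding abs_continuous_on_def by blast
  show thesis
    by (rule that[OF \<open>0 < \<delta>\<close>]) (use \<delta> in simp)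
qed

lemma abs_continuous_onD_interval:
  assumes "abs_continuous_on {a..b} f" "0 < \<epsilon>"
  obtains \<delta> where "0 < \<delta>"
    "\<And>s t. s \<in> {a..b} \<Longrightarrow> t \<in> {a..b} \<Longrightarrow> \<bar>s - t\<bar> < \<delta> \<Longrightarrow> norm (f s - f t) < \<epsilon>"
proof -
  obtain \<delta> where \<delta>: "0 < \<delta>"
    "\<And>D. D division_of \<Union>D \<Longrightarrow> \<Union>D \<subseteq> {a..b} \<Longrightarrow> (\<Sum>k\<in>D. Sup k - Inf k) < \<delta> \<Longrightarrow>
        (\<Sum>k\<in>D. norm (f (Sup k) - f (Inf k))) < \<epsilon>"
    using abs_continuous_onE[OF assms] by blast
  have *: "norm (f t - f s) < \<epsilon>" if "s \<in> {a..b}" "t \<in> {a..b}" "s \<le> t" "t - s < \<delta>" for s t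
  proof -
    have "{{s..t}} division_of \<Union>{{s..t}}"
      using that division_of_self[of s t] by simp
    from \<delta>(2)[OF this] that show ?thesis by auto
  qed
  show thesis
  proof
    fix s t assume "s \<in> {a..b}" "t \<in> {a..b}" "\<bar>s - t\<bar> < \<delta>"
    then show "norm (f s - f t) < \<epsilon>"
      using *[of s t] *[of t s] by (cases "s \<le> t") (auto simp: norm_minus_commute)
  qed fact
qed

lemma abs_continuous_on_imp_continuous_on:
  assumes "abs_continuous_on {a..b} f"
  shows "continuous_on {a..b} f"
  unfolding continuous_on_iff
proof (intro ballI allI impI)
  fix t \<epsilon> :: real assume t: "t \<in> {a..b}" and "0 < \<epsilon>"
  then obtain \<delta> where "0 < \<delta>"
    "\<And>s t. s \<in> {a..b} \<Longrightarrow> t \<in> {a..b} \<Longrightarrow> \<bar>s - t\<bar> < \<delta> \<Longrightarrow> norm (f s - f t) < \<epsilon>"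
    using abs_continuous_onD_interval[OF assms] by blast
  then show "\<exists>d>0. \<forall>s\<in>{a..b}. dist s t < d \<longrightarrow> dist (f s) (f t) < \<epsilon>"
    using t by (auto simp: dist_norm intro!: exI[of _ \<delta>])
qed

lemma abs_continuous_on_subset:
  assumes "abs_continuous_on S f" "S' \<subseteq> S"
  shows "abs_continuous_on S' f"
  unfolding abs_continuous_on_def
proof (intro allI impI)
  fix \<epsilon> :: real assume "0 < \<epsilon>"
  then obtain \<delta> where \<delta>: "0 < \<delta>"
    "\<And>D. D division_of \<Union>D \<Longrightarrow> \<Union>D \<subseteq> S \<Longrightarrow> (\<Sum>k\<in>D. Sup k - Inf k) < \<delta> \<Longrightarrow>
        (\<Sum>k\<in>D. norm (f (Sup k) - f (Inf k))) < \<epsilon>"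
    using abs_continuous_onE[OF assms(1)] by blast
  show "\<exists>\<delta>>0. \<forall>D. D division_of \<Union>D \<and> \<Union>D \<subseteq> S' \<and> (\<Sum>k\<in>D. Sup k - Inf k) < \<delta>
        \<longrightarrow> (\<Sum>k\<in>D. norm (f (Sup k) - f (Inf k))) < \<epsilon>"
    using \<delta> assms(2) by (intro exI[of _ \<delta>]) auto
qed

lemma abs_continuous_on_lipschitz_comp:
  assumes f: "abs_continuous_on {a..b} f"
    and g: "\<And>s t. s \<in> {a..b} \<Longrightarrow> t \<in> {a..b} \<Longrightarrow> norm (g s - g t) \<le> M * norm (f s - f t)"
  shows "abs_continuous_on {a..b} g"
  unfolding abs_continuous_on_def
proof (intro allI impI)
  fix \<epsilon> :: real assume "0 < \<epsilon>"
  \<comment> \<open>\<open>M\<close> may be zero or negative, and \<epsilon> has to be divided by a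
    positive constant.\<close>
  define M' where "M' = \<bar>M\<bar> + 1"
  have M': "0 < M'" "M \<le> M'" by (auto simp: M'_def)
  obtain \<delta> where \<delta>: "0 < \<delta>"
    "\<And>D. D division_of \<Union>D \<Longrightarrow> \<Union>D \<subseteq> {a..b} \<Longrightarrow> (\<Sum>k\<in>D. Sup k - Inf k) < \<delta> \<Longrightarrow>
        (\<Sum>k\<in>D. norm (f (Sup k) - f (Inf k))) < \<epsilon> / M'"
    using abs_continuous_onE[OF f divide_pos_pos[OF \<open>0 < \<epsilon>\<close> M'(1)]] by blast
  show "\<exists>\<delta>>0. \<forall>D. D division_of \<Union>D \<and> \<Union>D \<subseteq> {a..b} \<and> (\<Sum>k\<in>D. Sup k - Inf k) < \<delta>
        \<longrightarrow> (\<Sum>k\<in>D. norm (g (Sup k) - g (Inf k))) < \<epsilon>"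
  proof (intro exI conjI allI impI; (elim conjE)?)
    fix D assume D: "D division_of \<Union>D" "\<Union>D \<subseteq> {a..b}" "(\<Sum>k\<in>D. Sup k - Inf k) < \<delta>"
    have "(\<Sum>k\<in>D. norm (g (Sup k) - g (Inf k))) \<le> (\<Sum>k\<in>D. M' * norm (f (Sup k) - f (Inf k)))"
    proof (rule sum_mono)
      fix k assume k: "k \<in> D"
      then obtain u v where "k = {u..v}" "k \<noteq> {}"
        using division_ofD(3,4)[OF D(1)] by (metis box_real(2))
      then have uv: "k = {u..v}" "u \<le> v" by auto
      have "k \<subseteq> {a..b}" using k D(2) by blast
      with uv have "u \<in> {a..b}" "v \<in> {a..b}" by auto
      then have "norm (g v - g u) \<le> M * norm (f v - f u)" by (intro g)
      also have "\<dots> \<le> M' * norm (f v - f u)" using M' by (intro mult_right_mono) auto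
      finally show "norm (g (Sup k) - g (Inf k)) \<le> M' * norm (f (Sup k) - f (Inf k))"
        using uv by simp
    qed
    also have "\<dots> < M' * (\<epsilon> / M')"
      unfolding sum_distrib_left[symmetric]
      by (rule mult_strict_left_mono[OF \<delta>(2)[OF D] M'(1)])
    finally show "(\<Sum>k\<in>D. norm (g (Sup k) - g (Inf k))) < \<epsilon>" using M' by simp
  qed fact
qed

text \<open>A gauge proof: outside \<open>E\<close> the straddle estimate bounds the increments of \<open>f\<close>; tags in \<open>E\<close>
  are confined to an open set of small measure, where absolute continuity applies.\<close>

lemma abs_continuous_on_increment_le_integral:
  fixes f h :: "real \<Rightarrow> real"
  assumes ab: "a \<le> b" and ac: "abs_continuous_on {a..b} f" and E: "negligible E"
    and deriv: "\<And>t. t \<in> {a..b} - E \<Longrightarrow> \<exists>d. (f has_real_derivative d) (at t) \<and> d \<le> h t"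
    and h: "h integrable_on {a..b}"
  shows "f b - f a \<le> integral {a..b} h"
proof -
  let ?I = "integral {a..b} h"
  \<comment> \<open>Zeroing \<open>h\<close> on the null set keeps the integral and removes the
    uncontrolled values of \<open>h\<close> at tags in \<open>E\<close> from the Riemann
    sums.\<close>
  define h' where "h' t = (if t \<in> E then 0 else h t)" for t
  have h': "(h' has_integral ?I) {a..b}"
    by (rule has_integral_spike[OF E _ integrable_integral[OF h]]) (auto simp: h'_def)
  \<comment> \<open>The error budget: one \<open>e\<close> from the Riemann sum of
    \<open>h'\<close>, one from the intervals tagged in \<open>E\<close>, and
    \<open>e * (b - a)\<close> from the straddle estimates.\<close>
  have bound: "f b - f a \<le> ?I + e * (2 + (b - a))" if e: "0 < e" for e
  proof -
    obtain \<gamma> where \<gamma>: "gauge \<gamma>" and \<gamma>fine: "\<And>p. p tagged_division_of {a..b} \<Longrightarrow> \<gamma> fine p \<Longrightarrow>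
        norm ((\<Sum>(x,k)\<in>p. measure lborel k *\<^sub>R h' x) - ?I) < e"
      using h' e unfolding has_integral_real by meson
    obtain \<delta> where \<delta>: "0 < \<delta>"
      "\<And>D. D division_of \<Union>D \<Longrightarrow> \<Union>D \<subseteq> {a..b} \<Longrightarrow> (\<Sum>k\<in>D. Sup k - Inf k) < \<delta> \<Longrightarrow>
          (\<Sum>k\<in>D. norm (f (Sup k) - f (Inf k))) < e"
      using abs_continuous_onE[OF ac e] by blast
    have Enull: "E \<in> null_sets lebesgue" using E by (simp add: negligible_iff_null_sets)
    obtain V where V: "open V" "E \<subseteq> V" "V - E \<in> lmeasurable" "emeasure lebesgue (V - E) < ennreal \<delta>"
      using sets_lebesgue_outer_open[of E \<delta>] Enull \<delta>(1) by blast
    have V_eq: "emeasure lebesgue V = emeasure lebesgue (V - E)"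
      using V(1) Enull by (intro emeasure_Diff_null_set[symmetric]) auto
    then have Vm: "V \<in> lmeasurable"
      using V by (auto simp: fmeasurable_def)
    have mV: "measure lebesgue V < \<delta>"
      using V(4) Vm unfolding V_eq[symmetric] by (simp add: emeasure_eq_measure2 ennreal_less_iff)
    have "\<exists>r>0. \<forall>s\<in>ball t r. \<bar>f s - f t - (s - t) * d\<bar> \<le> e * \<bar>s - t\<bar>"
      if fd: "(f has_real_derivative d) (at t)" for t d
    proof -
      obtain r where r: "0 < r" "\<And>s. norm (s - t) < r \<Longrightarrow> norm (f s - f t - d * (s - t)) \<le> e * norm (s - t)"
          using fd[unfolded has_field_derivative_def has_derivative_at_alt, THEN conjunct2, rule_format, OF e]
        by auto
      show ?thesis
      proof (intro exI[of _ r] conjI ballI r(1))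
        fix s assume "s \<in> ball t r"
        then have "norm (s - t) < r" by (simp add: dist_real_def)
        from r(2)[OF this] show "\<bar>f s - f t - (s - t) * d\<bar> \<le> e * \<bar>s - t\<bar>" by (simp add: mult.commute)
      qed
    qed
    with deriv have "\<exists>r d. t \<in> {a..b} - E \<longrightarrow>
        0 < r \<and> (\<forall>s\<in>ball t r. \<bar>f s - f t - (s - t) * d\<bar> \<le> e * \<bar>s - t\<bar>) \<and> d \<le> h t" for t
      by meson
    then obtain r d where rd: "\<And>t. t \<in> {a..b} - E \<Longrightarrow>
        0 < r t \<and> (\<forall>s\<in>ball t (r t). \<bar>f s - f t - (s - t) * d t\<bar> \<le> e * \<bar>s - t\<bar>) \<and> d t \<le> h t"
      by metis
    define \<gamma>' where "\<gamma>' t = \<gamma> t \<inter> (if t \<in> E then V else if t \<in> {a..b} then ball t (r t) else UNIV)" for t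
    have "gauge \<gamma>'"
      using \<gamma> V(1,2) rd unfolding gauge_def \<gamma>'_def by auto
    then obtain p where p: "p tagged_division_of {a..b}" "\<gamma>' fine p"
      using fine_division_exists_real by blast
    have fin: "finite p" using p(1) by auto
    have pD: "\<exists>u v. K = {u..v} \<and> u \<le> x \<and> x \<le> v \<and> a \<le> u \<and> v \<le> b \<and> K \<subseteq> \<gamma>' x" if xK: "(x, K) \<in> p" for x K
    proof -
      obtain u v where uv: "K = {u..v}" using tagged_division_ofD(4)[OF p(1) xK] by auto
      have "x \<in> K" "K \<subseteq> {a..b}" "K \<subseteq> \<gamma>' x"
        using tagged_division_ofD(2,3)[OF p(1) xK] p(2) xK unfolding fine_def by auto
      with uv show ?thesis by (intro exI[of _ u] exI[of _ v]) auto
    qed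
    define pE where "pE = {(x, K) \<in> p. x \<in> E}"
    have pE: "pE \<subseteq> p" "finite pE" using fin by (auto simp: pE_def intro: finite_subset[of _ p])
    have fine: "\<gamma> fine p" using p(2) unfolding fine_def \<gamma>'_def by auto
    have good: "f (Sup K) - f (Inf K) \<le> measure lborel K * h' x + e * measure lborel K" if xK: "(x, K) \<in> p - pE" for x K
    proof -
      from xK obtain u v where uv: "K = {u..v}" "u \<le> x" "x \<le> v" "a \<le> u" "v \<le> b" "K \<subseteq> \<gamma>' x"
        using pD by blast
      have x: "x \<in> {a..b} - E" using uv xK by (auto simp: pE_def)
      then have sub: "{u..v} \<subseteq> ball x (r x)" using uv unfolding \<gamma>'_def by auto
      then have "v \<in> ball x (r x)" "u \<in> ball x (r x)" using uv(2,3) by (meson atLeastAtMost_iff order_refl order_trans subsetD)+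
      then have "\<bar>f v - f x - (v - x) * d x\<bar> \<le> e * \<bar>v - x\<bar>"
        "\<bar>f u - f x - (u - x) * d x\<bar> \<le> e * \<bar>u - x\<bar>"
        using rd[OF x] by blast+
      then have "f v - f u \<le> (v - x) * d x - (u - x) * d x + e * (v - x) + e * (x - u)"
        using uv by (auto simp: abs_if split: if_splits)
      also have "\<dots> = (v - u) * d x + e * (v - u)" by (simp add: algebra_simps)
      also have "\<dots> \<le> (v - u) * h x + e * (v - u)"
        using rd[OF x] uv by (auto intro: mult_left_mono)
      finally show ?thesis using uv x by (simp add: h'_def)
    qed
    have bad: "(\<Sum>(x,K)\<in>pE. f (Sup K) - f (Inf K)) \<le> e"
    proof -
      have tE: "pE tagged_division_of \<Union>(snd ` pE)"
        using p(1) pE(1) tagged_partial_division_of_Union_self tagged_partial_division_subset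
        unfolding tagged_division_of_def by metis
      have dE: "snd ` pE division_of \<Union>(snd ` pE)"
        by (rule division_of_tagged_division[OF tE])
      let ?D = "snd ` pE"
      have KD: "\<exists>u v. K = {u..v} \<and> u \<le> v \<and> a \<le> u \<and> v \<le> b \<and> K \<subseteq> V" if KD: "K \<in> ?D" for K
      proof -
        from KD obtain x where x: "(x, K) \<in> pE" by auto
        then have "x \<in> E" "(x, K) \<in> p" by (auto simp: pE_def)
        with pD[of x K] show ?thesis unfolding \<gamma>'_def by fastforce
      qed
      have "(\<Sum>K\<in>?D. Sup K - Inf K) = (\<Sum>K\<in>?D. measure lebesgue K)"
      proof (rule sum.cong)
        fix K assume "K \<in> ?D"
        with KD obtain u v where "K = {u..v}" "u \<le> v" by blast
        then show "Sup K - Inf K = measure lebesgue K" by simp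
      qed simp
      also have "\<dots> = measure lebesgue (\<Union>?D)"
        by (rule content_division[OF dE])
      also have "\<dots> \<le> measure lebesgue V"
        using KD Vm lmeasurable_division[OF dE] by (intro measure_mono_fmeasurable) blast+
      finally have small: "(\<Sum>K\<in>?D. norm (f (Sup K) - f (Inf K))) < e"
        using mV KD by (intro \<delta>(2)[OF dE]) fastforce+
      \<comment> \<open>Different tags can share an interval only if it is degenerate, so passing to
        a sum over intervals requires a summand that vanishes on every box with empty interior. The
        case distinction covers the empty box, where \<open>Sup\<close> and \<open>Inf\<close> carry
        no information.\<close>
      have "(\<Sum>(x,K)\<in>pE. f (Sup K) - f (Inf K)) =
          (\<Sum>(x,K)\<in>pE. if K = {} then 0 else f (Sup K) - f (Inf K))"
        using pD pE by (intro sum.cong) force+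
      also have "\<dots> = (\<Sum>K\<in>?D. if K = {} then 0 else f (Sup K) - f (Inf K))"
      proof (rule sum.over_tagged_division_lemma[OF tE])
        fix u v :: real assume "box u v = {}"
        then have "v \<le> u" by (simp add: greaterThanLessThan_empty_iff)
        then show "(if cbox u v = {} then 0 else f (Sup (cbox u v)) - f (Inf (cbox u v))) = 0"
          by (cases "u = v") auto
      qed
      also have "\<dots> \<le> (\<Sum>K\<in>?D. norm (f (Sup K) - f (Inf K)))"
        by (intro sum_mono) auto
      finally show ?thesis using small by linarith
    qed
    have cont: "(\<Sum>(x,K)\<in>p. measure lborel K) = b - a"
      using additive_content_tagged_division[of p a b] p(1) ab by simp
    have "f b - f a = (\<Sum>(x,K)\<in>p. f (Sup K) - f (Inf K))"
      using additive_tagged_division_1[OF ab p(1), of f] by simp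
    also have "\<dots> = (\<Sum>(x,K)\<in>p - pE. f (Sup K) - f (Inf K)) + (\<Sum>(x,K)\<in>pE. f (Sup K) - f (Inf K))"
      using sum.subset_diff[OF pE(1) fin] by blast
    also have "\<dots> \<le> (\<Sum>(x,K)\<in>p - pE. measure lborel K * h' x + e * measure lborel K) + e"
      using good bad by (intro add_mono sum_mono) auto
    \<comment> \<open>The terms added back have tags in \<open>E\<close>, where \<open>h'\<close> is
      0; they reduce to \<open>e\<close> times a length and are nonnegative.\<close>
    also have "(\<Sum>(x,K)\<in>p - pE. measure lborel K * h' x + e * measure lborel K)
        \<le> (\<Sum>(x,K)\<in>p. measure lborel K * h' x + e * measure lborel K)"
      using fin e pE by (intro sum_mono2) (auto simp: h'_def pE_def)
    also have "\<dots> = (\<Sum>(x,K)\<in>p. measure lborel K *\<^sub>R h' x) + e * (b - a)"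
      unfolding cont[symmetric] by (simp add: sum.distrib sum_distrib_left case_prod_unfold)
    finally show ?thesis
      using \<gamma>fine[OF p(1) fine] by (simp add: algebra_simps)
  qed
  show ?thesis
  proof (rule field_le_epsilon)
    fix e :: real assume "0 < e"
    then have "f b - f a \<le> ?I + e / (2 + (b - a)) * (2 + (b - a))"
      using ab by (intro bound) auto
    then show "f b - f a \<le> ?I + e" using ab by simp
  qed
qed

subsection \<open>From the data LMI to the Lyapunov--Metzler inequality\<close>

lemma sum_Plus:
  assumes "finite A" "finite B"
  shows "sum g (A <+> B) = (\<Sum>a\<in>A. g (Inl a)) + (\<Sum>b\<in>B. g (Inr b))"
  using sum.Plus[OF assms, of g] by (simp add: o_def)

lemma imat_transpose_imat_transpose: "imat_transpose (imat_transpose M) = M"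
  by (simp add: imat_transpose_def)

lemma sum_mult_sum_mult_assoc:
  fixes v w :: "_ \<Rightarrow> real"
  shows "(\<Sum>r\<in>S. v r * (\<Sum>k\<in>I. X r k * w k)) = (\<Sum>k\<in>I. (\<Sum>r\<in>S. v r * X r k) * w k)"
  unfolding sum_distrib_left sum_distrib_right
  by (subst sum.swap) (simp add: mult.assoc)

lemma quadratic_form_eq:
  fixes v :: "_ \<Rightarrow> real"
  shows "(\<Sum>r\<in>S. \<Sum>c\<in>S. v r * M r c * v c) = (\<Sum>r\<in>S. v r * (\<Sum>c\<in>S. M r c * v c))"
  by (simp add: sum_distrib_left mult.assoc)

text \<open>This brings the noise bound and the data LMI to a common form: each is the form of
  \<Phi> at the vector \<open>G^T v\<close>. The two can be compared as soon as these vectors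
  agree.\<close>

lemma quadratic_form_congruence:
  "(\<Sum>r\<in>S. \<Sum>c\<in>S. v r * imat_mult I (imat_mult I G \<Phi>) (imat_transpose G) r c * v c) =
   (\<Sum>l\<in>I. \<Sum>k\<in>I. (\<Sum>r\<in>S. v r * G r l) * \<Phi> l k * (\<Sum>r\<in>S. v r * G r k))"
proof -
  let ?g = "\<lambda>l. \<Sum>r\<in>S. v r * G r l"
  let ?X = "imat_mult I G \<Phi>"
  have "(\<Sum>c\<in>S. imat_mult I ?X (imat_transpose G) r c * v c) = (\<Sum>k\<in>I. ?X r k * ?g k)" for r
    using sum_mult_sum_mult_assoc[where v = v and S = S and I = I and X = G and w = "?X r"]
    by (simp add: imat_mult_def[of I ?X] imat_transpose_def mult.commute)
  then have "(\<Sum>r\<in>S. \<Sum>c\<in>S. v r * imat_mult I ?X (imat_transpose G) r c * v c) =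
      (\<Sum>r\<in>S. v r * (\<Sum>k\<in>I. ?X r k * ?g k))"
    unfolding quadratic_form_eq by simp
  also have "\<dots> = (\<Sum>k\<in>I. (\<Sum>r\<in>S. v r * ?X r k) * ?g k)"
    by (rule sum_mult_sum_mult_assoc)
  also have "(\<lambda>k. \<Sum>r\<in>S. v r * ?X r k) = (\<lambda>k. \<Sum>l\<in>I. ?g l * \<Phi> l k)"
    unfolding imat_mult_def by (rule ext) (rule sum_mult_sum_mult_assoc)
  also have "(\<Sum>k\<in>I. (\<Sum>l\<in>I. ?g l * \<Phi> l k) * ?g k) = (\<Sum>l\<in>I. ?g l * (\<Sum>k\<in>I. \<Phi> l k * ?g k))"
    by (rule sum_mult_sum_mult_assoc[symmetric])
  finally show ?thesis by (simp only: quadratic_form_eq)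
qed

section \<open>Positive definite matrices and inverses, for fixed dimensions and for index
  sets\<close>

lemma bilinear_form_vec:
  fixes M :: "real^'c::finite^'r::finite"
  shows "(\<Sum>r\<in>UNIV. \<Sum>c\<in>UNIV. u $ r * M $ r $ c * y $ c) = u \<bullet> (M *v y)"
  by (simp add: inner_vec_def matrix_vector_mult_def sum_distrib_left mult.assoc)

lemma inner_transpose_mult:
  fixes M :: "real^'c::finite^'r::finite"
  shows "u \<bullet> (transpose M *v y) = (M *v u) \<bullet> y"
  by (metis dot_lmul_matrix inner_commute transpose_matrix_vector vector_transpose_matrix)

lemma pos_def_transpose: "pos_def M \<Longrightarrow> transpose M = M"
  by (simp add: pos_def_def pos_def_on_def symmetric_on_def ent_def transpose_def vec_eq_iff)

lemma pos_def_inner_commute: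
  assumes "pos_def M"
  shows "u \<bullet> (M *v y) = (M *v u) \<bullet> y"
  using inner_transpose_mult[of u M y] pos_def_transpose[OF assms] by simp

lemma pos_def_inner_pos:
  assumes "pos_def M" "x \<noteq> 0"
  shows "0 < x \<bullet> (M *v x)"
proof -
  have "\<exists>r\<in>UNIV. x $ r \<noteq> 0" using assms(2) by (auto simp: vec_eq_iff)
  then show ?thesis
    using assms(1) unfolding pos_def_def pos_def_on_def ent_def bilinear_form_vec[symmetric] by blast
qed

lemma pos_def_invertible:
  assumes "pos_def M"
  shows "invertible M"
proof -
  have "x = 0" if "M *v x = 0" for x
    using pos_def_inner_pos[OF assms, of x] that by force
  then show ?thesis
    using invertible_left_inverse matrix_left_invertible_ker by blast
qed

lemma matrix_inv_right_left:
  fixes M :: "real^'n::finite^'n"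
  assumes "invertible M"
  shows "M ** matrix_inv M = mat 1 \<and> matrix_inv M ** M = mat 1"
  using assms unfolding invertible_def matrix_inv_def by (rule someI_ex)

lemma matrix_inv_mult_vec:
  fixes M :: "real^'n::finite^'n"
  assumes "invertible M"
  shows "matrix_inv M *v (M *v x) = x" "M *v (matrix_inv M *v x) = x"
  using assms by (simp_all add: matrix_vector_mul_assoc matrix_inv_right_left)

lemma pos_def_matrix_inv_inner_commute:
  assumes "pos_def M"
  shows "u \<bullet> (matrix_inv M *v y) = (matrix_inv M *v u) \<bullet> y"
  using pos_def_inner_commute[OF assms, of "matrix_inv M *v u" "matrix_inv M *v y"]
  by (simp add: matrix_inv_mult_vec[OF pos_def_invertible[OF assms]])

text \<open>\<open>imat_inv\<close> is a choice, so nothing is known about it until some two-sided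
  inverse \<open>B\<close> is exhibited; even then only its entries on \<open>S\<close> are
  determined.\<close>

lemma imat_inv_inverse:
  assumes "\<And>r c. r \<in> S \<Longrightarrow> c \<in> S \<Longrightarrow> imat_mult S M B r c = imat_id r c"
    "\<And>r c. r \<in> S \<Longrightarrow> c \<in> S \<Longrightarrow> imat_mult S B M r c = imat_id r c"
    and "r \<in> S" "c \<in> S"
  shows "imat_mult S M (imat_inv S M) r c = imat_id r c"
    "imat_mult S (imat_inv S M) M r c = imat_id r c"
proof -
  have "\<forall>r\<in>S. \<forall>c\<in>S. imat_mult S M (imat_inv S M) r c = imat_id r c \<and>
      imat_mult S (imat_inv S M) M r c = imat_id r c"
    unfolding imat_inv_def by (rule someI[of _ B]) (use assms in blast)
  with assms(3,4) show "imat_mult S M (imat_inv S M) r c = imat_id r c"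
    "imat_mult S (imat_inv S M) M r c = imat_id r c" by blast+
qed

lemma sum_block_diag_row:
  fixes M :: "'j \<Rightarrow> real^'n::finite^'n"
  assumes "finite J" "j \<in> J"
  shows "(\<Sum>c\<in>J \<times> UNIV. block_diag M (j, a) c * y c) = (\<Sum>b\<in>UNIV. M j $ a $ b * y (j, b))"
proof -
  have "(\<Sum>c\<in>J \<times> UNIV. block_diag M (j, a) c * y c) =
      (\<Sum>l\<in>J. if l = j then \<Sum>b\<in>UNIV. M j $ a $ b * y (j, b) else 0)"
    unfolding block_diag_def sum.cartesian_product'
    by (intro sum.cong) auto
  then show ?thesis using assms by simp
qed

lemma sum_block_diag_column:
  fixes M :: "'j \<Rightarrow> real^'n::finite^'n"
  assumes "finite J" "j \<in> J"
  shows "(\<Sum>r\<in>J \<times> UNIV. y r * block_diag M r (j, b)) = (\<Sum>a\<in>UNIV. y (j, a) * M j $ a $ b)"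
proof -
  have "(\<Sum>r\<in>J \<times> UNIV. y r * block_diag M r (j, b)) =
      (\<Sum>l\<in>J. if l = j then \<Sum>a\<in>UNIV. y (j, a) * M j $ a $ b else 0)"
    unfolding block_diag_def sum.cartesian_product'
    by (intro sum.cong) auto
  then show ?thesis using assms by simp
qed

lemma imat_mult_block_diag:
  fixes M M' :: "'j \<Rightarrow> real^'n::finite^'n"
  assumes "finite J" "j \<in> J"
  shows "imat_mult (J \<times> UNIV) (block_diag M) (block_diag M') (j, a) (l, b) =
    block_diag (\<lambda>j. M j ** M' j) (j, a) (l, b)"
  unfolding imat_mult_def sum_block_diag_row[OF assms]
  by (simp add: block_diag_def matrix_matrix_mult_def)

lemma imat_inv_block_diag:
  fixes M :: "'j \<Rightarrow> real^'n::finite^'n"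
  assumes J: "finite J" and M: "\<And>j. j \<in> J \<Longrightarrow> invertible (M j)"
    and "r \<in> J \<times> UNIV" "c \<in> J \<times> UNIV"
  shows "imat_mult (J \<times> UNIV) (block_diag M) (imat_inv (J \<times> UNIV) (block_diag M)) r c = imat_id r c"
    "imat_mult (J \<times> UNIV) (imat_inv (J \<times> UNIV) (block_diag M)) (block_diag M) r c = imat_id r c"
proof -
  have *: "imat_mult (J \<times> UNIV) (block_diag M1) (block_diag M2) r c = imat_id r c"
    if r: "r \<in> J \<times> UNIV" and M: "\<And>j. j \<in> J \<Longrightarrow> M1 j ** M2 j = mat 1" for r c and M1 M2 :: "'j \<Rightarrow> real^'n^'n"
  proof -
    obtain j a l b where rc: "r = (j, a)" "j \<in> J" "c = (l, b)" using r by (metis SigmaE surj_pair)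
    then show ?thesis
      using M[OF rc(2)] by (simp only: rc imat_mult_block_diag[OF J]) (auto simp: block_diag_def mat_def imat_id_def)
  qed
  \<comment> \<open>The block diagonal of the individual inverses is the witness that justifies the
    choice inside \<open>imat_inv\<close>.\<close>
  have 1: "imat_mult (J \<times> UNIV) (block_diag M) (block_diag (\<lambda>j. matrix_inv (M j))) r c = imat_id r c"
    "imat_mult (J \<times> UNIV) (block_diag (\<lambda>j. matrix_inv (M j))) (block_diag M) r c = imat_id r c"
    if "r \<in> J \<times> UNIV" for r c
    using that M by (intro *; simp add: matrix_inv_right_left)+
  show "imat_mult (J \<times> UNIV) (block_diag M) (imat_inv (J \<times> UNIV) (block_diag M)) r c = imat_id r c"
    "imat_mult (J \<times> UNIV) (imat_inv (J \<times> UNIV) (block_diag M)) (block_diag M) r c = imat_id r c"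
    using imat_inv_inverse[OF 1 assms(3,4)] by blast+
qed

lemma sum_imat_id:
  assumes "finite S" "r \<in> S"
  shows "(\<Sum>c\<in>S. imat_id r c * y c) = y r" "(\<Sum>c\<in>S. y c * imat_id c r) = y r"
  using assms by (simp_all add: imat_id_def if_distrib if_distribR cong: if_cong)

text \<open>Evaluates \<open>w^T Da^{-1} Db^{-1} w\<close> without computing an inverse:
  \<open>w\<close> is written as \<open>u^T Da\<close> for the left factor and as
  \<open>Db y\<close> for the right one, so each inverse cancels and \<open>u^T y\<close>
  remains.\<close>

lemma quadratic_form_inverse_product:
  fixes u y w :: "'a \<Rightarrow> real"
  assumes S: "finite S"
    and I1: "\<And>r c. r \<in> S \<Longrightarrow> c \<in> S \<Longrightarrow> imat_mult S Da I1 r c = imat_id r c"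
    and I2: "\<And>r c. r \<in> S \<Longrightarrow> c \<in> S \<Longrightarrow> imat_mult S I2 Db r c = imat_id r c"
    and w1: "\<And>c. c \<in> S \<Longrightarrow> w c = (\<Sum>r\<in>S. u r * Da r c)"
    and w2: "\<And>r. r \<in> S \<Longrightarrow> w r = (\<Sum>c\<in>S. Db r c * y c)"
  shows "(\<Sum>r\<in>S. \<Sum>c\<in>S. w r * imat_mult S I1 I2 r c * w c) = (\<Sum>k\<in>S. u k * y k)"
proof -
  have 1: "(\<Sum>r\<in>S. w r * I1 r k) = u k" if "k \<in> S" for k
  proof -
    have "(\<Sum>r\<in>S. w r * I1 r k) = (\<Sum>r\<in>S. (\<Sum>s\<in>S. u s * Da s r) * I1 r k)"
      using w1 by simp
    also have "\<dots> = (\<Sum>s\<in>S. u s * imat_mult S Da I1 s k)"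
      unfolding imat_mult_def by (rule sum_mult_sum_mult_assoc[symmetric])
    also have "\<dots> = (\<Sum>s\<in>S. u s * imat_id s k)" using I1 that by simp
    finally show ?thesis using sum_imat_id[OF S that] by simp
  qed
  have 2: "(\<Sum>c\<in>S. I2 k c * w c) = y k" if "k \<in> S" for k
  proof -
    have "(\<Sum>c\<in>S. I2 k c * w c) = (\<Sum>c\<in>S. I2 k c * (\<Sum>s\<in>S. Db c s * y s))"
      using w2 by simp
    also have "\<dots> = (\<Sum>s\<in>S. imat_mult S I2 Db k s * y s)"
      unfolding imat_mult_def by (rule sum_mult_sum_mult_assoc)
    also have "\<dots> = (\<Sum>s\<in>S. imat_id k s * y s)" using I2 that by simp
    finally show ?thesis using sum_imat_id[OF S that] by simp
  qed
  have "(\<Sum>c\<in>S. imat_mult S I1 I2 r c * w c) = (\<Sum>k\<in>S. I1 r k * y k)" for r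
  proof -
    have "(\<Sum>c\<in>S. imat_mult S I1 I2 r c * w c) = (\<Sum>k\<in>S. I1 r k * (\<Sum>c\<in>S. I2 k c * w c))"
      unfolding imat_mult_def by (rule sum_mult_sum_mult_assoc[symmetric])
    then show ?thesis using 2 by simp
  qed
  then have "(\<Sum>r\<in>S. \<Sum>c\<in>S. w r * imat_mult S I1 I2 r c * w c) = (\<Sum>r\<in>S. w r * (\<Sum>k\<in>S. I1 r k * y k))"
    unfolding quadratic_form_eq by simp
  also have "\<dots> = (\<Sum>k\<in>S. (\<Sum>r\<in>S. w r * I1 r k) * y k)"
    by (rule sum_mult_sum_mult_assoc)
  finally show ?thesis using 1 by simp
qed

lemma other_modes_quadratic_form:
  fixes P :: "nat \<Rightarrow> real^'n::finite^'n"
  assumes P: "\<And>j. j \<in> {1..N} \<Longrightarrow> invertible (P j)"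
    and \<pi>: "\<And>j. j \<in> {1..N} - {i} \<Longrightarrow> 0 < \<pi> j i"
    and w: "w = (\<lambda>(j, a). - (\<pi> j i * (P j *v x) $ a))"
    and S: "S = other_modes_index N i"
  shows "(\<Sum>r\<in>S. \<Sum>c\<in>S. w r * imat_mult S (imat_inv S (block_diag (\<lambda>j. mat (\<pi> j i))))
            (imat_inv S (block_diag P)) r c * w c) = (\<Sum>j\<in>{1..N} - {i}. \<pi> j i * (x \<bullet> (P j *v x)))"
proof -
  let ?J = "{1..N} - {i}"
  have S': "S = ?J \<times> UNIV" using S by (simp add: other_modes_index_def)
  have inv_mat: "invertible (mat c :: real^'n^'n)" if "0 < c" for c
    unfolding invertible_def
  proof (intro exI[of _ "mat (inverse c)"] conjI)
    show "mat c ** mat (inverse c) = (mat 1 :: real^'n^'n)" "mat (inverse c) ** mat c = (mat 1 :: real^'n^'n)"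
      using that by (simp_all add: matrix_matrix_mult_def mat_def vec_eq_iff mult_delta_left)
  qed
  have "(\<Sum>r\<in>S. \<Sum>c\<in>S. w r * imat_mult S (imat_inv S (block_diag (\<lambda>j. mat (\<pi> j i))))
            (imat_inv S (block_diag P)) r c * w c)
      = (\<Sum>k\<in>S. (case k of (j, a) \<Rightarrow> - (P j *v x) $ a) * (case k of (j, a) \<Rightarrow> - (\<pi> j i * x $ a)))"
  proof (rule quadratic_form_inverse_product[where Da = "block_diag (\<lambda>j. mat (\<pi> j i))" and Db = "block_diag P"])
    have inv: "\<And>j. j \<in> ?J \<Longrightarrow> invertible (mat (\<pi> j i) :: real^'n^'n)" "\<And>j. j \<in> ?J \<Longrightarrow> invertible (P j)"
      using P \<pi> inv_mat by blast+
    fix r c assume "r \<in> S" "c \<in> S"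
    then have rc: "r \<in> ?J \<times> UNIV" "c \<in> ?J \<times> UNIV" by (simp_all only: S')
    show "imat_mult S (block_diag (\<lambda>j. mat (\<pi> j i))) (imat_inv S (block_diag (\<lambda>j. mat (\<pi> j i)))) r c
        = imat_id r c"
      unfolding S' by (rule imat_inv_block_diag(1)[OF _ inv(1) rc]) simp_all
    show "imat_mult S (imat_inv S (block_diag P)) (block_diag P) r c = imat_id r c"
      unfolding S' by (rule imat_inv_block_diag(2)[OF _ inv(2) rc]) simp_all
  next
    fix c assume "c \<in> S"
    then obtain j b where jb: "c = (j, b)" "j \<in> ?J" by (cases c) (auto simp: S')
    show "w c = (\<Sum>r\<in>S. (case r of (j, a) \<Rightarrow> - (P j *v x) $ a) * block_diag (\<lambda>j. mat (\<pi> j i)) r c)"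
      unfolding S' jb using jb(2)
      by (subst sum_block_diag_column) (auto simp: w mat_def if_distrib cong: if_cong)
    show "w c = (\<Sum>r\<in>S. block_diag P c r * (case r of (j, a) \<Rightarrow> - (\<pi> j i * x $ a)))"
      unfolding S' jb using jb(2)
      by (subst sum_block_diag_row) (auto simp: w matrix_vector_mult_def sum_distrib_left sum_negf mult_ac)
  qed (simp add: S')
  also have "\<dots> = (\<Sum>j\<in>?J. \<pi> j i * (x \<bullet> (P j *v x)))"
    unfolding S' sum.cartesian_product'
    by (simp add: inner_vec_def sum_distrib_left mult_ac)
  finally show ?thesis .
qed

text \<open>The last two diagonal blocks are zero, so the form is affine in \<eta> and \<zeta>.
  These are the slots through which the unknown dynamics enter, as \<open>A^T \<xi>\<close> and
  \<open>B^T \<xi>\<close>.\<close>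

lemma lmi_block_quadratic_form:
  fixes P :: "nat \<Rightarrow> real^'n::finite^'n" and L :: "real^'n^'m::finite"
    and \<xi> \<eta> :: "real^'n" and \<zeta> :: "real^'m"
  assumes v: "v = case_sum (\<lambda>(j, a). w j $ a) (case_sum (vec_nth \<xi>) (case_sum (vec_nth \<eta>) (vec_nth \<zeta>)))"
    and Q: "Q = matrix_inv (P i)" and S: "S = other_modes_index N i"
  shows "(\<Sum>r\<in>lmi_index N i. \<Sum>c\<in>lmi_index N i. v r * lmi_block N \<pi> P L Y i r c * v c) =
    (\<Sum>r\<in>S. \<Sum>c\<in>S. (\<lambda>(j, a). w j $ a) r * imat_mult S (imat_inv S (block_diag (\<lambda>j. mat (\<pi> j i))))
            (imat_inv S (block_diag P)) r c * (\<lambda>(j, a). w j $ a) c)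
    + (\<Sum>j\<in>{1..N} - {i}. w j \<bullet> (Q *v \<xi>)) + (\<Sum>j\<in>{1..N} - {i}. \<xi> \<bullet> (Q *v w j))
    - \<pi> i i * (\<xi> \<bullet> (Q *v \<xi>)) - \<xi> \<bullet> (Y *v \<xi>) - \<xi> \<bullet> (Q *v \<eta>) - \<xi> \<bullet> (transpose L *v \<zeta>)
    - \<eta> \<bullet> (Q *v \<xi>) - \<zeta> \<bullet> (L *v \<xi>)"
proof -
  let ?J = "{1..N} - {i}"
  let ?w = "\<lambda>(j, a). w j $ a"
  have S': "S = ?J \<times> UNIV" using S by (simp add: other_modes_index_def)
  have fin: "finite S" by (simp add: S')
  have G1: "imat_mult UNIV ones_kron_id (ent Q) (j, a) b = Q $ a $ b" for j :: nat and a b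
    using sum_imat_id(1)[of UNIV a "\<lambda>c. Q $ c $ b"] by (simp add: imat_mult_def ones_kron_id_def ent_def)
  have G2: "imat_mult UNIV (ent Q) (imat_transpose ones_kron_id) a (j, b) = Q $ a $ b" for j :: nat and a b
    using sum_imat_id(1)[of UNIV b "\<lambda>c. Q $ a $ c"]
    by (simp add: imat_mult_def ones_kron_id_def ent_def imat_transpose_def mult.commute)
  have T1: "(\<Sum>r\<in>S. \<Sum>b\<in>UNIV. ?w r * imat_mult UNIV ones_kron_id (ent Q) r b * \<xi> $ b) = (\<Sum>j\<in>?J. w j \<bullet> (Q *v \<xi>))"
    unfolding S' sum.cartesian_product' by (simp add: G1 bilinear_form_vec)
  have T2: "(\<Sum>a\<in>UNIV. \<Sum>c\<in>S. \<xi> $ a * imat_mult UNIV (ent Q) (imat_transpose ones_kron_id) a c * ?w c)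
      = (\<Sum>j\<in>?J. \<xi> \<bullet> (Q *v w j))"
    unfolding S' sum.cartesian_product'
    by (rule trans[OF sum.swap]) (simp add: G2 bilinear_form_vec)
  have T3: "(\<Sum>a\<in>UNIV. \<Sum>b\<in>UNIV. \<xi> $ a * (- (\<pi> i i *\<^sub>R Q) - Y) $ a $ b * \<xi> $ b) =
      - (\<pi> i i * (\<xi> \<bullet> (Q *v \<xi>))) - \<xi> \<bullet> (Y *v \<xi>)"
    unfolding bilinear_form_vec[symmetric]
    by (simp add: algebra_simps sum_subtractf sum.distrib sum_negf sum_distrib_left)
  have T4: "(\<Sum>a\<in>UNIV. \<Sum>b\<in>UNIV. u $ a * (- M) $ a $ b * y $ b) = - (u \<bullet> (M *v y))"
    for M :: "real^'c::finite^'d::finite" and u y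
    unfolding bilinear_form_vec[symmetric] by (simp add: sum_negf)
  show ?thesis
    unfolding v lmi_index_def lmi_block_def Let_def S[symmetric] Q[symmetric]
    by (simp add: sum_Plus fin hcat_def vcat_def imat_zero_def sum.distrib
        T1 T2 T3 T4 ent_def[of "- Q"] ent_def[of "- transpose L"] ent_def[of "- L"] ent_def[of "- (\<pi> i i *\<^sub>R Q) - Y"] del: UNIV_Plus_UNIV vector_uminus_component vector_minus_component)
qed

text \<open>Paired with \<open>A^T \<xi>\<close> and \<open>B^T \<xi>\<close>, the rows
  \<open>- X\<close> and \<open>- U\<close> subtract from \<open>Xd\<close> exactly the part
  explained by the true system, leaving the noise. The zero first block row of
  \<open>Gamma_block\<close> keeps \<open>w\<close> free for the Schur complement.\<close>

lemma Gamma_block_column_eq: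
  fixes A :: "real^'n::finite^'n" and B :: "real^'m::finite^'n" and \<xi> :: "real^'n"
  assumes v: "v = case_sum w (case_sum (vec_nth \<xi>)
      (case_sum (vec_nth (transpose A *v \<xi>)) (vec_nth (transpose B *v \<xi>))))"
    and Xd: "\<And>r k. k < T \<Longrightarrow> Xd r k = imat_mult UNIV (ent A) X r k + imat_mult UNIV (ent B) U r k + W r k"
    and l: "l \<in> data_index T"
  shows "(\<Sum>r\<in>lmi_index N i. v r * Gamma_block Xd X U r l) =
    (\<Sum>r\<in>UNIV. \<xi> $ r * imat_transpose (imat_id vcat imat_transpose W) r l)"
proof -
  have fin: "finite (other_modes_index N i :: (nat \<times> 'n) set)" by (simp add: other_modes_index_def)
  have tr: "(\<Sum>a\<in>UNIV. (transpose M *v \<xi>) $ a * Z a) = (\<Sum>r\<in>UNIV. \<xi> $ r * (\<Sum>a\<in>UNIV. M $ r $ a * Z a))"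
    for M :: "real^'c::finite^'n" and Z
    unfolding sum_mult_sum_mult_assoc by (simp add: matrix_vector_mult_def transpose_def mult.commute)
  show ?thesis
  proof (cases l)
    case (Inl a)
    then show ?thesis
      unfolding v lmi_index_def
      by (simp add: sum_Plus fin Gamma_block_def vcat_def hcat_def imat_zero_def imat_transpose_def imat_id_def
          if_distrib cong: if_cong del: UNIV_Plus_UNIV)
  next
    case (Inr k)
    then have k: "k < T" using l by (auto simp: data_index_def)
    show ?thesis
      unfolding v lmi_index_def Inr
      by (simp add: sum_Plus fin Gamma_block_def vcat_def hcat_def imat_zero_def imat_transpose_def
          imat_minus_def sum_negf tr Xd[OF k] imat_mult_def ent_def distrib_left sum.distrib del: UNIV_Plus_UNIV transpose_matrix_vector)
  qed
qed

text \<open>The test vector \<open>(w, \<xi>, A\<^sup>T \<xi>, B\<^sup>T \<xi>)\<close> is mapped by \<open>\<Gamma>\<^sup>T\<close> to \<open>(\<xi>, W\<^sup>T \<xi>)\<close>, so the noise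
  bound makes the \<open>\<Phi>\<close>-term nonnegative; \<open>\<xi> = P\<^sub>i x\<close> and \<open>w\<^sub>j = - \<pi>\<^sub>j\<^sub>i P\<^sub>j x\<close> is the minimiser over \<open>w\<close>,
  i.e. a Schur complement.\<close>

lemma lyapunov_metzler_inequality:
  fixes P :: "nat \<Rightarrow> real^'n::finite^'n" and L :: "real^'n^'m::finite"
  assumes i: "i \<in> {1..N}"
    and W: "W \<in> noise_set T \<Phi>"
    and Xd: "\<And>r k. k < T \<Longrightarrow> Xd r k = imat_mult UNIV (ent A) X r k + imat_mult UNIV (ent B) U r k + W r k"
    and P: "\<And>j. j \<in> {1..N} \<Longrightarrow> pos_def (P j)"
    and \<alpha>: "0 \<le> \<alpha>"
    and \<pi>: "\<pi> \<in> metzler_plus N"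
    and lmi: "pos_semidef_on (lmi_index N i) (\<lambda>r c. lmi_block N \<pi> P L Y i r c
        - \<alpha> * imat_mult (data_index T) (imat_mult (data_index T) (Gamma_block Xd X U) \<Phi>)
                  (imat_transpose (Gamma_block Xd X U)) r c)"
  shows "vdot (P i) x ((A + B ** (L ** P i)) *v x) + (\<Sum>j\<in>{1..N}. \<pi> j i * (x \<bullet> (P j *v x)))
      \<le> - ((P i *v x) \<bullet> (Y *v (P i *v x)))"
proof -
  let ?J = "{1..N} - {i}"
  let ?D = "data_index T :: ('n + nat) set" and ?S = "lmi_index N i :: ((nat \<times> 'n) + 'n + 'n + 'm) set"
  let ?G = "Gamma_block Xd X U"
  let ?Z = "imat_transpose (imat_id vcat imat_transpose W)"
  define \<xi> where "\<xi> = P i *v x"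
  define w where "w j = - (\<pi> j i *\<^sub>R (P j *v x))" for j
  define Q where "Q = matrix_inv (P i)"
  define v where "v = case_sum (\<lambda>(j, a). w j $ a) (case_sum (vec_nth \<xi>)
      (case_sum (vec_nth (transpose A *v \<xi>)) (vec_nth (transpose B *v \<xi>))))"
  note Pi = P[OF i]
  have Q\<xi>: "Q *v \<xi> = x"
    unfolding Q_def \<xi>_def by (rule matrix_inv_mult_vec[OF pos_def_invertible[OF Pi]])
  have Qc: "u \<bullet> (Q *v y) = (Q *v u) \<bullet> y" for u y
    unfolding Q_def by (rule pos_def_matrix_inv_inner_commute[OF Pi])
  have "0 \<le> (\<Sum>r\<in>UNIV. \<Sum>c\<in>UNIV. \<xi> $ r * imat_mult ?D (imat_mult ?D ?Z \<Phi>) (imat_transpose ?Z) r c * \<xi> $ c)"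
    using W unfolding noise_set_def pos_semidef_on_def
    by (simp add: imat_transpose_imat_transpose)
  also have "\<dots> = (\<Sum>l\<in>?D. \<Sum>k\<in>?D. (\<Sum>r\<in>UNIV. \<xi> $ r * ?Z r l) * \<Phi> l k * (\<Sum>r\<in>UNIV. \<xi> $ r * ?Z r k))"
    by (rule quadratic_form_congruence)
  also have "\<dots> = (\<Sum>l\<in>?D. \<Sum>k\<in>?D. (\<Sum>r\<in>?S. v r * ?G r l) * \<Phi> l k * (\<Sum>r\<in>?S. v r * ?G r k))"
    by (intro sum.cong refl) (simp add: Gamma_block_column_eq[OF v_def Xd])
  also have "\<dots> = (\<Sum>r\<in>?S. \<Sum>c\<in>?S. v r * imat_mult ?D (imat_mult ?D ?G \<Phi>) (imat_transpose ?G) r c * v c)"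
    by (rule quadratic_form_congruence[symmetric])
  finally have "0 \<le> \<alpha> * (\<Sum>r\<in>?S. \<Sum>c\<in>?S. v r * imat_mult ?D (imat_mult ?D ?G \<Phi>) (imat_transpose ?G) r c * v c)"
    using \<alpha> by simp
  also have "\<dots> \<le> (\<Sum>r\<in>?S. \<Sum>c\<in>?S. v r * lmi_block N \<pi> P L Y i r c * v c)"
  proof -
    have "0 \<le> (\<Sum>r\<in>?S. \<Sum>c\<in>?S. v r * (lmi_block N \<pi> P L Y i r c
        - \<alpha> * imat_mult ?D (imat_mult ?D ?G \<Phi>) (imat_transpose ?G) r c) * v c)"
      using lmi unfolding pos_semidef_on_def by blast
    also have "\<dots> = (\<Sum>r\<in>?S. \<Sum>c\<in>?S. v r * lmi_block N \<pi> P L Y i r c * v c)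
        - \<alpha> * (\<Sum>r\<in>?S. \<Sum>c\<in>?S. v r * imat_mult ?D (imat_mult ?D ?G \<Phi>) (imat_transpose ?G) r c * v c)"
      by (simp add: right_diff_distrib left_diff_distrib sum_subtractf sum_distrib_left mult_ac)
    finally show ?thesis by simp
  qed
  also have "\<dots> = (\<Sum>j\<in>?J. \<pi> j i * (x \<bullet> (P j *v x)))
      + (\<Sum>j\<in>?J. w j \<bullet> (Q *v \<xi>)) + (\<Sum>j\<in>?J. \<xi> \<bullet> (Q *v w j))
      - \<pi> i i * (\<xi> \<bullet> (Q *v \<xi>)) - \<xi> \<bullet> (Y *v \<xi>) - \<xi> \<bullet> (Q *v (transpose A *v \<xi>))
      - \<xi> \<bullet> (transpose L *v (transpose B *v \<xi>))
      - (transpose A *v \<xi>) \<bullet> (Q *v \<xi>) - (transpose B *v \<xi>) \<bullet> (L *v \<xi>)"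
  proof -
    have "(\<Sum>r\<in>other_modes_index N i. \<Sum>c\<in>other_modes_index N i. (\<lambda>(j, a). w j $ a) r *
          imat_mult (other_modes_index N i) (imat_inv (other_modes_index N i) (block_diag (\<lambda>j. mat (\<pi> j i))))
            (imat_inv (other_modes_index N i) (block_diag P)) r c * (\<lambda>(j, a). w j $ a) c)
        = (\<Sum>j\<in>?J. \<pi> j i * (x \<bullet> (P j *v x)))"
      using P \<pi> i by (intro other_modes_quadratic_form)
        (auto simp: metzler_plus_def w_def intro: pos_def_invertible)
    then show ?thesis
      unfolding lmi_block_quadratic_form[where N = N and \<pi> = \<pi> and Y = Y and w = w and P = P and i = i, OF v_def Q_def refl] by simp
  qed
  \<comment> \<open>Since \<open>Q \<xi> = x\<close>, each of the two cross sums gives minus the sum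
    over the other modes and the first block gives it once with a plus. One negative copy survives,
    and the \<pi>-term of the second diagonal block completes it to the sum over all modes.\<close>
  also have "\<dots> = - (\<Sum>j\<in>{1..N}. \<pi> j i * (x \<bullet> (P j *v x))) - \<xi> \<bullet> (Y *v \<xi>)
      - vdot (P i) x ((A + B ** (L ** P i)) *v x)"
  proof -
    have "(\<Sum>j\<in>?J. w j \<bullet> (Q *v \<xi>)) = - (\<Sum>j\<in>?J. \<pi> j i * (x \<bullet> (P j *v x)))"
      "(\<Sum>j\<in>?J. \<xi> \<bullet> (Q *v w j)) = - (\<Sum>j\<in>?J. \<pi> j i * (x \<bullet> (P j *v x)))"
      unfolding Qc Q\<xi> by (simp_all add: w_def sum_negf inner_commute)
    moreover have "(\<Sum>j\<in>{1..N}. \<pi> j i * (x \<bullet> (P j *v x))) =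
        \<pi> i i * (x \<bullet> \<xi>) + (\<Sum>j\<in>?J. \<pi> j i * (x \<bullet> (P j *v x)))"
      using i by (simp add: sum.remove \<xi>_def)
    moreover have "vdot (P i) x ((A + B ** (L ** P i)) *v x) =
        2 * ((A *v x) \<bullet> \<xi>) + 2 * ((B *v (L *v \<xi>)) \<bullet> \<xi>)"
      unfolding vdot_def pos_def_inner_commute[OF Pi, of x]
      by (simp add: \<xi>_def[symmetric] matrix_vector_mult_add_rdistrib matrix_vector_mul_assoc[symmetric]
          inner_add_left inner_add_right inner_commute)
    moreover have "(transpose A *v \<xi>) \<bullet> x = (A *v x) \<bullet> \<xi>"
      "(transpose B *v \<xi>) \<bullet> (L *v \<xi>) = (B *v (L *v \<xi>)) \<bullet> \<xi>"
      by (metis inner_commute inner_transpose_mult)+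
    ultimately show ?thesis
      unfolding Qc Q\<xi> inner_transpose_mult inner_commute[of \<xi> x] by linarith
  qed
  finally show ?thesis unfolding \<xi>_def by simp
qed

text \<open>A Schur complement by test vector: for fixed \<xi> the form is least at first component
  \<open>- z\<close>, where its value is
  \<open>\<xi> \<bullet> (Y *v \<xi>) - z \<bullet> z\<close>. Taking \<open>\<xi> = P *v x\<close>
  cancels the inverse in \<open>H\<close> and turns \<open>z\<close> into the closed-loop output of
  the mode.\<close>

lemma perf_block_bound:
  fixes C :: "real^'n::finite^'p::finite" and D :: "real^'m::finite^'p" and P :: "real^'n^'n"
  assumes P: "pos_def P" and perf: "pos_def_on UNIV (perf_block C D P L Y)" and "x \<noteq> 0"
  shows "((C + D ** (L ** P)) *v x) \<bullet> ((C + D ** (L ** P)) *v x) < (P *v x) \<bullet> (Y *v (P *v x))"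
proof -
  define H where "H = C ** matrix_inv P + D ** L"
  define \<xi> where "\<xi> = P *v x"
  define z where "z = H *v \<xi>"
  define v where "v = case_sum (vec_nth (- z)) (vec_nth \<xi>)"
  have "\<xi> \<noteq> 0"
    using \<open>x \<noteq> 0\<close> pos_def_inner_pos[OF P] unfolding \<xi>_def by force
  then obtain a where "\<xi> $ a \<noteq> 0" by (auto simp: vec_eq_iff)
  then have "\<exists>r\<in>UNIV. v r \<noteq> 0" by (intro bexI[of _ "Inr a"]) (auto simp: v_def)
  then have "0 < (\<Sum>r\<in>UNIV. \<Sum>c\<in>UNIV. v r * perf_block C D P L Y r c * v c)"
    using perf unfolding pos_def_on_def by blast
  also have "\<dots> = z \<bullet> z + (- z) \<bullet> (H *v \<xi>) + \<xi> \<bullet> (transpose H *v (- z)) + \<xi> \<bullet> (Y *v \<xi>)"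
    unfolding bilinear_form_vec[symmetric] perf_block_def Let_def H_def[symmetric] UNIV_Plus_UNIV[symmetric]
    by (simp add: sum_Plus v_def hcat_def vcat_def ent_def imat_id_def inner_vec_def if_distrib if_distribR sum.distrib
        cong: if_cong del: UNIV_Plus_UNIV)
  also have "\<dots> = \<xi> \<bullet> (Y *v \<xi>) - z \<bullet> z"
    unfolding inner_transpose_mult by (simp add: z_def)
  finally have "z \<bullet> z < \<xi> \<bullet> (Y *v \<xi>)" by simp
  moreover have "z = (C + D ** (L ** P)) *v x"
    unfolding z_def \<xi>_def H_def
    by (simp add: matrix_vector_mult_add_rdistrib matrix_vector_mul_assoc[symmetric]
        matrix_inv_mult_vec[OF pos_def_invertible[OF P]])
  ultimately show ?thesis unfolding \<xi>_def by simp
qed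

subsection \<open>Descent of the minimum of the quadratic forms\<close>

definition min_quad :: "nat \<Rightarrow> (nat \<Rightarrow> real^'n::finite^'n) \<Rightarrow> real^'n \<Rightarrow> real" where
  "min_quad N P x = Min ((\<lambda>i. x \<bullet> (P i *v x)) ` {1..N})"

lemma min_quad_le: "i \<in> {1..N} \<Longrightarrow> min_quad N P x \<le> x \<bullet> (P i *v x)"
  unfolding min_quad_def by (intro Min_le) auto

lemma min_quad_attained:
  assumes "1 \<le> N"
  obtains i where "i \<in> {1..N}" "min_quad N P x = x \<bullet> (P i *v x)"
proof -
  have "min_quad N P x \<in> (\<lambda>i. x \<bullet> (P i *v x)) ` {1..N}"
    unfolding min_quad_def using assms by (intro Min_in) auto
  then show thesis using that by blast
qed

lemma switch_minimal:
  assumes "1 \<le> N"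
  shows "switch N P x \<in> {1..N}" "j \<in> {1..N} \<Longrightarrow> x \<bullet> (P (switch N P x) *v x) \<le> x \<bullet> (P j *v x)"
proof -
  let ?M = "{i. is_arg_min (\<lambda>i. x \<bullet> (P i *v x)) (\<lambda>i. i \<in> {1..N}) i}"
  obtain i where i: "i \<in> {1..N}" "min_quad N P x = x \<bullet> (P i *v x)"
    using min_quad_attained[OF assms] by blast
  have "i \<in> ?M"
    using i min_quad_le[where N = N and P = P and x = x] by (fastforce simp: is_arg_min_linorder)
  moreover have "finite ?M"
    by (rule finite_subset[of _ "{1..N}"]) (auto simp: is_arg_min_def)
  ultimately have "switch N P x \<in> ?M"
    unfolding switch_def by (intro Min_in) auto
  then show "switch N P x \<in> {1..N}" "j \<in> {1..N} \<Longrightarrow> x \<bullet> (P (switch N P x) *v x) \<le> x \<bullet> (P j *v x)"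
    by (auto simp: is_arg_min_linorder)
qed

text \<open>The order between two quadratic forms is a closed condition on the state, so it passes
  from the cell of mode \<open>i\<close> to its closure.\<close>

lemma active_minimal:
  assumes "1 \<le> N" "i \<in> active N P x" "j \<in> {1..N}"
  shows "x \<bullet> (P i *v x) \<le> x \<bullet> (P j *v x)"
proof -
  have "closed {y. y \<bullet> (P i *v y) \<le> y \<bullet> (P j *v y)}"
    by (intro closed_Collect_le continuous_intros)
  moreover have "{y. switch N P y = i} \<subseteq> {y. y \<bullet> (P i *v y) \<le> y \<bullet> (P j *v y)}"
    using switch_minimal(2)[OF assms(1,3)] by auto
  ultimately have "closure {y. switch N P y = i} \<subseteq> {y. y \<bullet> (P i *v y) \<le> y \<bullet> (P j *v y)}"
    by (rule closure_minimal[rotated])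
  then show ?thesis using assms(2) unfolding active_def by auto
qed

lemma active_subset: "active N P x \<subseteq> {1..N}"
  by (auto simp: active_def)

text \<open>The maximum over the unit sphere is attained and hence negative; homogeneity of degree
  two carries this value from the sphere to all of space.\<close>

lemma homogeneous_negative_margin:
  fixes \<phi> :: "'a::euclidean_space \<Rightarrow> real"
  assumes cont: "continuous_on UNIV \<phi>" and hom: "\<And>r x. \<phi> (r *\<^sub>R x) = r\<^sup>2 * \<phi> x"
    and neg: "\<And>x. x \<noteq> 0 \<Longrightarrow> \<phi> x < 0"
  shows "\<exists>c>0. \<forall>x. \<phi> x \<le> - c * (x \<bullet> x)"
proof -
  have "sphere 0 1 \<noteq> ({} :: 'a set)" by simp
  then obtain y where y: "y \<in> sphere 0 1" "\<And>x. x \<in> sphere 0 1 \<Longrightarrow> \<phi> x \<le> \<phi> y"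
    using continuous_attains_sup[of "sphere 0 1" \<phi>] continuous_on_subset[OF cont] by (metis compact_sphere subset_UNIV)
  show ?thesis
  proof (intro exI[of _ "- \<phi> y"] conjI allI)
    show "0 < - \<phi> y" using neg[of y] y(1) by force
    fix x :: 'a
    show "\<phi> x \<le> - (- \<phi> y) * (x \<bullet> x)"
    proof (cases "x = 0")
      case True
      then show ?thesis using hom[of 0 x] by simp
    next
      case False
      have "\<phi> x = (norm x)\<^sup>2 * \<phi> (x /\<^sub>R norm x)"
        using False by (simp flip: hom)
      also have "\<dots> \<le> (norm x)\<^sup>2 * \<phi> y"
        using False by (intro mult_left_mono y) auto
      finally show ?thesis by (simp add: dot_square_norm mult.commute)
    qed
  qed
qed

lemma finite_uniform_margin:
  fixes \<phi> :: "'i \<Rightarrow> 'a::real_inner \<Rightarrow> real"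
  assumes "finite I" "\<And>i. i \<in> I \<Longrightarrow> \<exists>c>0. \<forall>x. \<phi> i x \<le> - c * (x \<bullet> x)"
  shows "\<exists>c>0. \<forall>i\<in>I. \<forall>x. \<phi> i x \<le> - c * (x \<bullet> x)"
proof -
  obtain c where c: "\<And>i. i \<in> I \<Longrightarrow> 0 < c i" "\<And>i x. i \<in> I \<Longrightarrow> \<phi> i x \<le> - c i * (x \<bullet> x)"
    using assms(2) by metis
  \<comment> \<open>The inserted 1 keeps the minimum defined and positive when \<open>I\<close> is
    empty.\<close>
  define m where "m = Min (insert 1 (c ` I))"
  have "0 < m" unfolding m_def using assms(1) c(1) by (subst Min_gr_iff) auto
  moreover have "\<phi> i x \<le> - m * (x \<bullet> x)" if "i \<in> I" for i x
  proof -
    have "m \<le> c i" unfolding m_def using assms(1) that by (intro Min_le) auto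
    then have "m * (x \<bullet> x) \<le> c i * (x \<bullet> x)" by (intro mult_right_mono) auto
    then show ?thesis using c(2)[OF that, of x] by simp
  qed
  ultimately show ?thesis by blast
qed

lemma matrices_uniformly_bounded:
  fixes P :: "'i \<Rightarrow> real^'n::finite^'m::finite"
  assumes "finite I"
  obtains b where "0 < b" "\<And>i x. i \<in> I \<Longrightarrow> norm (P i *v x) \<le> b * norm x"
proof -
  have "\<exists>b>0. \<forall>x. norm (P i *v x) \<le> norm x * b" for i
    using bounded_linear.pos_bounded[OF matrix_vector_mul_bounded_linear[of "P i"]] by blast
  then obtain b where b: "\<And>i. 0 < b i" "\<And>i x. norm (P i *v x) \<le> norm x * b i"
    by metis
  define m where "m = Max (insert 1 (b ` I))"
  have m: "1 \<le> m" "\<And>i. i \<in> I \<Longrightarrow> b i \<le> m"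
    unfolding m_def using assms by auto
  show thesis
  proof
    show "0 < m" using m by simp
    show "norm (P i *v x) \<le> m * norm x" if "i \<in> I" for i x
      using b(2)[of i x] mult_left_mono[OF m(2)[OF that], of "norm x"] by (simp add: mult.commute)
  qed
qed

text \<open>The mode that is minimal at \<open>y\<close> also bounds the minimum at
  \<open>x\<close>, so a single quadratic form has to be compared at two points; exchanging them
  gives the absolute value. This estimate transfers absolute continuity from a bounded piece of
  trajectory to \<open>min_quad\<close> along it.\<close>

lemma min_quad_lipschitz:
  fixes P :: "nat \<Rightarrow> real^'n::finite^'n"
  assumes N: "1 \<le> N" and b: "\<And>i x. i \<in> {1..N} \<Longrightarrow> norm (P i *v x) \<le> b * norm x"
    and b0: "0 < b" and "norm x \<le> R" "norm y \<le> R"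
  shows "\<bar>min_quad N P x - min_quad N P y\<bar> \<le> 2 * b * R * norm (x - y)"
proof -
  have *: "min_quad N P x \<le> min_quad N P y + 2 * b * R * norm (x - y)"
    if "norm x \<le> R" "norm y \<le> R" for x y
  proof -
    obtain i where i: "i \<in> {1..N}" "min_quad N P y = y \<bullet> (P i *v y)"
      using min_quad_attained[OF N] by blast
    have "x \<bullet> (P i *v x) - y \<bullet> (P i *v y) = x \<bullet> (P i *v (x - y)) + (x - y) \<bullet> (P i *v y)"
      by (simp add: matrix_vector_mult_diff_distrib inner_diff_left inner_diff_right)
    also have "\<dots> \<le> norm x * norm (P i *v (x - y)) + norm (x - y) * norm (P i *v y)"
      by (intro add_mono norm_cauchy_schwarz)
    also have "\<dots> \<le> R * (b * norm (x - y)) + norm (x - y) * (b * R)"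
    proof (intro add_mono mult_mono)
      show "norm (P i *v y) \<le> b * R"
        using b[OF i(1), of y] mult_left_mono[OF that(2), of b] b0 by linarith
    qed (use that b[OF i(1)] b0 order_trans[OF norm_ge_zero that(1)] in auto)
    finally show ?thesis
      using min_quad_le[OF i(1), of P x] i(2) by (simp add: algebra_simps)
  qed
  show ?thesis
    using *[of x y] *[of y x] assms(4,5) by (auto simp: abs_le_iff norm_minus_commute)
qed

text \<open>The gap is the weighted variance of \<open>z\<close> about its mean
  \<open>m\<close>.\<close>

lemma inner_weighted_sum_le:
  fixes z :: "'i \<Rightarrow> 'a::real_inner"
  assumes "\<And>i. i \<in> I \<Longrightarrow> 0 \<le> a i" "sum a I = 1"
  shows "(\<Sum>i\<in>I. a i *\<^sub>R z i) \<bullet> (\<Sum>i\<in>I. a i *\<^sub>R z i) \<le> (\<Sum>i\<in>I. a i * (z i \<bullet> z i))"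
proof -
  define m where "m = (\<Sum>i\<in>I. a i *\<^sub>R z i)"
  have "0 \<le> (\<Sum>i\<in>I. a i * ((z i - m) \<bullet> (z i - m)))"
    using assms(1) by (intro sum_nonneg mult_nonneg_nonneg) auto
  also have "\<dots> = (\<Sum>i\<in>I. a i * (z i \<bullet> z i)) - 2 * (\<Sum>i\<in>I. a i * (z i \<bullet> m)) + (\<Sum>i\<in>I. a i * (m \<bullet> m))"
    by (simp add: inner_diff_left inner_diff_right inner_commute algebra_simps sum.distrib sum_subtractf
        sum_distrib_left)
  also have "(\<Sum>i\<in>I. a i * (z i \<bullet> m)) = m \<bullet> m"
    by (simp add: m_def[symmetric] inner_sum_left[of "\<lambda>i. a i *\<^sub>R z i" I m, unfolded m_def[symmetric], simplified])
  also have "(\<Sum>i\<in>I. a i * (m \<bullet> m)) = m \<bullet> m"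
    using assms(2) by (simp flip: sum_distrib_right)
  finally show ?thesis by (simp add: m_def)
qed

section \<open>The derivative of \<open>min_quad\<close> along solutions\<close>

lemma vdot_scaleR: "vdot P x (r *\<^sub>R y) = r * vdot P x y"
  by (simp add: vdot_def matrix_vector_mult_scaleR distrib_left)

lemma quad_has_real_derivative:
  fixes P :: "real^'n::finite^'n"
  assumes "(x has_vector_derivative x') (at t)"
  shows "((\<lambda>s. x s \<bullet> (P *v x s)) has_real_derivative vdot P (x t) x') (at t)"
proof -
  have P: "bounded_linear ((*v) P)" by (rule matrix_vector_mul_bounded_linear)
  have "((\<lambda>s. x s \<bullet> (P *v x s)) has_derivative
      (\<lambda>h. x t \<bullet> (P *v (h *\<^sub>R x')) + (h *\<^sub>R x') \<bullet> (P *v x t))) (at t)"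
    using assms unfolding has_vector_derivative_def
    by (intro has_derivative_inner bounded_linear.has_derivative[OF P])
  then show ?thesis
    unfolding has_field_derivative_def
    by (rule has_derivative_eq_rhs) (auto simp: vdot_def matrix_vector_mult_scaleR algebra_simps)
qed

text \<open>The interface between the matrix inequalities and the trajectories. It speaks of each
  form along its own field only, and only at states where the mode is active, because there the
  Metzler term can be discarded.\<close>

definition decreasing_along_active ::
  "nat \<Rightarrow> (nat \<Rightarrow> real^'n::finite^'n) \<Rightarrow> (nat \<Rightarrow> real^'n^'n) \<Rightarrow> (nat \<Rightarrow> real^'m::finite^'n)
    \<Rightarrow> (nat \<Rightarrow> real^'n^'p::finite) \<Rightarrow> (nat \<Rightarrow> real^'m^'p) \<Rightarrow> (nat \<Rightarrow> real^'n^'m) \<Rightarrow> real \<Rightarrow> bool" where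
  "decreasing_along_active N P A B C D K c \<longleftrightarrow> (\<forall>x. \<forall>i\<in>active N P x.
     vdot (P i) x ((A i + B i ** K i) *v x)
       \<le> - c * (x \<bullet> x) - ((C i + D i ** K i) *v x) \<bullet> ((C i + D i ** K i) *v x))"

lemma min_quad_derivative_le:
  assumes N: "1 \<le> N" and dec: "decreasing_along_active N P A B C D K c"
    and sol: "closed_loop_solution N P A B E K (\<lambda>_. 0) x a"
  obtains S where "negligible S"
    "\<And>t. 0 \<le> t \<Longrightarrow> t \<notin> S \<Longrightarrow> \<exists>d. ((\<lambda>s. min_quad N P (x s)) has_real_derivative d) (at t) \<and>
      d \<le> - (c * (x t \<bullet> x t)) - modified_output N P C D F K (\<lambda>_. 0) x a t \<bullet> modified_output N P C D F K (\<lambda>_. 0) x a t"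
proof -
  define M where "M i = A i + B i ** K i" for i
  define Z where "Z i = C i + D i ** K i" for i
  define J where "J t = active N P (x t)" for t
  define x' where "x' t = (\<Sum>i\<in>J t. a i t *\<^sub>R (M i *v x t))" for t
  define good where "good t \<longleftrightarrow> (\<forall>i\<in>J t. 0 \<le> a i t) \<and> (\<Sum>i\<in>J t. a i t) = 1 \<and>
      (x has_vector_derivative x' t) (at t) \<and>
      vdot (P (switch N P (x t))) (x t) (x' t) \<le> (\<Sum>i\<in>J t. vdot (P i) (x t) (a i t *\<^sub>R (M i *v x t)))" for t
  have "AE t in lebesgue. 0 \<le> t \<longrightarrow> good t"
    using sol unfolding closed_loop_solution_def good_def J_def x'_def M_def mode_field_def
    by (simp add: matrix_vector_mult_0_right)
  then obtain S1 where S1: "\<And>t. t \<in> space lebesgue - S1 \<Longrightarrow> 0 \<le> t \<longrightarrow> good t" "S1 \<in> null_sets lebesgue"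
    using AE_E3 by blast
  obtain S2 where S2: "countable S2"
    "\<And>t g' i. t \<notin> S2 \<Longrightarrow> (\<And>j. j \<in> {1..N} \<Longrightarrow> ((\<lambda>s. x s \<bullet> (P j *v x s)) has_real_derivative g' j) (at t)) \<Longrightarrow>
       i \<in> {1..N} \<Longrightarrow> (\<And>j. j \<in> {1..N} \<Longrightarrow> x t \<bullet> (P i *v x t) \<le> x t \<bullet> (P j *v x t)) \<Longrightarrow>
       ((\<lambda>s. Min ((\<lambda>j. x s \<bullet> (P j *v x s)) ` {1..N})) has_real_derivative g' i) (at t)"
    using Min_has_real_derivative_off_countable[of "{1..N}" "\<lambda>j s. x s \<bullet> (P j *v x s)"] N by auto
  show thesis
  proof
    show "negligible (S1 \<union> S2)"
      using S1(2) S2(1) by (auto simp: negligible_iff_null_sets intro: null_sets_completionI[OF countable_imp_null_set_lborel])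
    fix t :: real assume t: "0 \<le> t" "t \<notin> S1 \<union> S2"
    then have g: "good t" using S1(1)[of t] by simp
    let ?i = "switch N P (x t)"
    let ?z = "modified_output N P C D F K (\<lambda>_. 0) x a t"
    have z: "?z = (\<Sum>i\<in>J t. a i t *\<^sub>R (Z i *v x t))"
      unfolding modified_output_def J_def Z_def by (simp add: matrix_vector_mult_0_right)
    have "((\<lambda>s. min_quad N P (x s)) has_real_derivative vdot (P ?i) (x t) (x' t)) (at t)"
      unfolding min_quad_def
    proof (rule S2(2)[of t "\<lambda>j. vdot (P j) (x t) (x' t)" ?i])
      show "((\<lambda>s. x s \<bullet> (P j *v x s)) has_real_derivative vdot (P j) (x t) (x' t)) (at t)" for j
        using g by (intro quad_has_real_derivative) (simp add: good_def)
      show "?i \<in> {1..N}" by (rule switch_minimal(1)[OF N])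
      show "x t \<bullet> (P ?i *v x t) \<le> x t \<bullet> (P j *v x t)" if "j \<in> {1..N}" for j
        by (rule switch_minimal(2)[OF N that])
    qed (use t in simp)
    \<comment> \<open>The inequality in the solution concept passes from the mixed field to the
      individual ones; the same weights then produce the margin, as they sum to 1, and the output
      term, by convexity.\<close>
    moreover have "vdot (P ?i) (x t) (x' t) \<le> - (c * (x t \<bullet> x t)) - ?z \<bullet> ?z"
    proof -
      have "vdot (P ?i) (x t) (x' t) \<le> (\<Sum>i\<in>J t. a i t * vdot (P i) (x t) (M i *v x t))"
        using g by (simp add: good_def vdot_scaleR)
      also have "\<dots> \<le> (\<Sum>i\<in>J t. a i t * (- c * (x t \<bullet> x t) - (Z i *v x t) \<bullet> (Z i *v x t)))"
        using g dec by (intro sum_mono mult_left_mono) (auto simp: good_def decreasing_along_active_def J_def M_def Z_def)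
      also have "\<dots> = (\<Sum>i\<in>J t. a i t) * (- c * (x t \<bullet> x t)) - (\<Sum>i\<in>J t. a i t * ((Z i *v x t) \<bullet> (Z i *v x t)))"
        by (simp add: right_diff_distrib sum_subtractf sum_distrib_right sum_negf)
      also have "\<dots> \<le> - (c * (x t \<bullet> x t)) - ?z \<bullet> ?z"
        using g inner_weighted_sum_le[of "J t" "\<lambda>i. a i t" "\<lambda>i. Z i *v x t"] by (simp add: good_def z)
      finally show ?thesis .
    qed
    ultimately show "\<exists>d. ((\<lambda>s. min_quad N P (x s)) has_real_derivative d) (at t) \<and> d \<le> - (c * (x t \<bullet> x t)) - ?z \<bullet> ?z"
      by blast
  qed
qed

text \<open>An integrable minorant \<open>h\<close> stands in for the decay rate, whose output part
  comes without an integrability statement. Different choices of \<open>h\<close> serve all later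
  purposes: 0 for monotonicity, a constant for decay, and a simple function plus part of the margin
  for the output energy.\<close>

lemma min_quad_descent:
  assumes N: "1 \<le> N" and dec: "decreasing_along_active N P A B C D K c"
    and sol: "closed_loop_solution N P A B E K (\<lambda>_. 0) x a"
    and st: "0 \<le> s" "s \<le> t" and h: "h integrable_on {s..t}"
    and le: "\<And>\<tau>. \<tau> \<in> {s..t} \<Longrightarrow> h \<tau> \<le> c * (x \<tau> \<bullet> x \<tau>) +
        modified_output N P C D F K (\<lambda>_. 0) x a \<tau> \<bullet> modified_output N P C D F K (\<lambda>_. 0) x a \<tau>"
  shows "min_quad N P (x t) + integral {s..t} h \<le> min_quad N P (x s)"
proof -
  have ac: "abs_continuous_on {s..t} x"
    using sol st by (auto simp: closed_loop_solution_def intro: abs_continuous_on_subset[of "{0..t}"])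
  obtain b where b: "0 < b" "\<And>i x. i \<in> {1..N} \<Longrightarrow> norm (P i *v x) \<le> b * norm x"
    using matrices_uniformly_bounded[of "{1..N}" P] by auto
  have "bounded (x ` {s..t})"
    by (intro compact_imp_bounded compact_continuous_image abs_continuous_on_imp_continuous_on ac) simp
  then obtain R where R: "\<And>\<tau>. \<tau> \<in> {s..t} \<Longrightarrow> norm (x \<tau>) \<le> R"
    unfolding bounded_iff by blast
  have acV: "abs_continuous_on {s..t} (\<lambda>\<tau>. min_quad N P (x \<tau>))"
    using min_quad_lipschitz[OF N b(2,1) R R]
    by (intro abs_continuous_on_lipschitz_comp[OF ac, where M = "2 * b * R"]) simp
  obtain S where S: "negligible S"
    "\<And>t. 0 \<le> t \<Longrightarrow> t \<notin> S \<Longrightarrow> \<exists>d. ((\<lambda>s. min_quad N P (x s)) has_real_derivative d) (at t) \<and>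
      d \<le> - (c * (x t \<bullet> x t)) - modified_output N P C D F K (\<lambda>_. 0) x a t \<bullet> modified_output N P C D F K (\<lambda>_. 0) x a t"
    using min_quad_derivative_le[OF N dec sol] by blast
  have "min_quad N P (x t) - min_quad N P (x s) \<le> integral {s..t} (\<lambda>\<tau>. - h \<tau>)"
  proof (rule abs_continuous_on_increment_le_integral[OF st(2) acV S(1)])
    fix \<tau> assume \<tau>: "\<tau> \<in> {s..t} - S"
    then obtain d where "((\<lambda>s. min_quad N P (x s)) has_real_derivative d) (at \<tau>)"
      "d \<le> - (c * (x \<tau> \<bullet> x \<tau>)) - modified_output N P C D F K (\<lambda>_. 0) x a \<tau> \<bullet> modified_output N P C D F K (\<lambda>_. 0) x a \<tau>"
      using S(2)[of \<tau>] st by auto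
    with le[of \<tau>] \<tau> show "\<exists>d. ((\<lambda>s. min_quad N P (x s)) has_real_derivative d) (at \<tau>) \<and> d \<le> - h \<tau>"
      by (intro exI[of _ d]) auto
  qed (use h in \<open>rule integrable_neg\<close>)
  then show ?thesis by (simp add: integral_neg)
qed

section \<open>Two-sided bounds on \<open>min_quad\<close> and asymptotic stability\<close>

lemma min_quad_nonneg:
  assumes "1 \<le> N" "\<forall>i\<in>{1..N}. pos_def (P i)"
  shows "0 \<le> min_quad N P x"
proof -
  obtain i where "i \<in> {1..N}" "min_quad N P x = x \<bullet> (P i *v x)"
    using min_quad_attained[OF assms(1)] by blast
  then show ?thesis
    using assms(2) pos_def_inner_pos[of "P i" x] by (cases "x = 0") auto
qed

lemma min_quad_bounds:
  fixes P :: "nat \<Rightarrow> real^'n::finite^'n"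
  assumes N: "1 \<le> N" and P: "\<forall>i\<in>{1..N}. pos_def (P i)"
  shows "\<exists>m>0. \<exists>M>0. \<forall>x. m * (x \<bullet> x) \<le> min_quad N P x \<and> min_quad N P x \<le> M * (x \<bullet> x)"
proof -
  have "\<exists>m>0. \<forall>i\<in>{1..N}. \<forall>x. - (x \<bullet> (P i *v x)) \<le> - m * (x \<bullet> x)"
  proof (rule finite_uniform_margin)
    fix i assume "i \<in> {1..N}"
    then show "\<exists>c>0. \<forall>x. - (x \<bullet> (P i *v x)) \<le> - c * (x \<bullet> x)"
      using P pos_def_inner_pos[of "P i"]
      by (intro homogeneous_negative_margin continuous_intros)
         (auto simp: matrix_vector_mult_scaleR power2_eq_square)
  qed simp
  then obtain m where m: "0 < m" "\<And>i x. i \<in> {1..N} \<Longrightarrow> m * (x \<bullet> x) \<le> x \<bullet> (P i *v x)"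
    by auto
  obtain b where b: "0 < b" "\<And>i x. i \<in> {1..N} \<Longrightarrow> norm (P i *v x) \<le> b * norm x"
    using matrices_uniformly_bounded[of "{1..N}" P] by auto
  show ?thesis
  proof (rule exI[of _ m], rule conjI[OF m(1)], rule exI[of _ b], rule conjI[OF b(1)], intro allI conjI)
    fix x
    obtain i where i: "i \<in> {1..N}" "min_quad N P x = x \<bullet> (P i *v x)"
      using min_quad_attained[OF N] by blast
    then show "m * (x \<bullet> x) \<le> min_quad N P x" using m by simp
    have "x \<bullet> (P i *v x) \<le> norm x * norm (P i *v x)" by (rule norm_cauchy_schwarz)
    also have "\<dots> \<le> norm x * (b * norm x)" using b(2)[OF i(1)] by (intro mult_left_mono) auto
    finally show "min_quad N P x \<le> b * (x \<bullet> x)"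
      using i by (simp add: dot_square_norm power2_eq_square mult_ac)
  qed
qed

text \<open>Monotonicity of \<open>min_quad\<close> makes its final value on \<open>{0..t}\<close> a
  lower bound throughout, hence the decay rate is at least a constant multiple of that value. This
  gives a bound of order \<open>1 / t\<close> without a Gronwall argument, which suffices for
  convergence.\<close>

lemma closed_loop_globally_asymptotically_stable:
  fixes P :: "nat \<Rightarrow> real^'n::finite^'n"
  assumes N: "1 \<le> N" and P: "\<forall>i\<in>{1..N}. pos_def (P i)"
    and dec: "decreasing_along_active N P A B C D K c" and c: "0 < c"
  shows "globally_asymptotically_stable {x. \<exists>a. closed_loop_solution N P A B E K (\<lambda>_. 0) x a}"
proof -
  obtain m M where m: "0 < m" "\<And>x. m * (x \<bullet> x) \<le> min_quad N P x"
    and M: "0 < M" "\<And>x. min_quad N P x \<le> M * (x \<bullet> x)"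
    using min_quad_bounds[OF N P] by blast
  let ?V = "min_quad N P"
  have mono: "?V (x t) \<le> ?V (x s)"
    if "closed_loop_solution N P A B E K (\<lambda>_. 0) x a" "0 \<le> s" "s \<le> t" for x a s t
    using min_quad_descent[OF N dec that, where h = "\<lambda>_. 0" and F = "\<lambda>_. 0", OF integrable_0] c by simp
  have decay: "?V (x t) * (1 + c / M * t) \<le> ?V (x 0)"
    if sol: "closed_loop_solution N P A B E K (\<lambda>_. 0) x a" and "0 \<le> t" for x a t
  proof -
    have "c / M * ?V (x t) \<le> c * (x \<tau> \<bullet> x \<tau>)" if "\<tau> \<in> {0..t}" for \<tau>
    proof -
      have "?V (x t) \<le> M * (x \<tau> \<bullet> x \<tau>)"
        using mono[OF sol, of \<tau> t] M(2)[of "x \<tau>"] that by auto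
      then have "c / M * ?V (x t) \<le> c / M * (M * (x \<tau> \<bullet> x \<tau>))"
        using c M(1) by (intro mult_left_mono) auto
      then show ?thesis using M(1) by simp
    qed
    then have "?V (x t) + integral {0..t} (\<lambda>_. c / M * ?V (x t)) \<le> ?V (x 0)"
      using \<open>0 \<le> t\<close> by (intro min_quad_descent[OF N dec sol, where F = "\<lambda>_. 0"]) (auto intro: add_increasing2)
    then show ?thesis using \<open>0 \<le> t\<close> by (simp add: algebra_simps)
  qed
  have "\<exists>\<delta>>0. \<forall>x\<in>{x. \<exists>a. closed_loop_solution N P A B E K (\<lambda>_. 0) x a}.
      norm (x 0) < \<delta> \<longrightarrow> (\<forall>t\<ge>0. norm (x t) < \<epsilon>)" if "0 < \<epsilon>" for \<epsilon>
  \<comment> \<open>The radius comes from the chain \<open>m * (norm (x t))^2 \<le> V (x t) \<le> V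
    (x 0) \<le> M * (norm (x 0))^2\<close>, with \<open>V\<close> for
    \<open>min_quad N P\<close>.\<close>
  proof (intro exI[of _ "sqrt (m / M) * \<epsilon>"] conjI ballI impI allI)
    show "0 < sqrt (m / M) * \<epsilon>" using that m M by simp
    fix x and t :: real
    assume "x \<in> {x. \<exists>a. closed_loop_solution N P A B E K (\<lambda>_. 0) x a}"
      and x0: "norm (x 0) < sqrt (m / M) * \<epsilon>" and "0 \<le> t"
    then obtain a where sol: "closed_loop_solution N P A B E K (\<lambda>_. 0) x a" by blast
    have "m * (norm (x t))\<^sup>2 \<le> M * (norm (x 0))\<^sup>2"
      using m(2)[of "x t"] M(2)[of "x 0"] mono[OF sol order_refl \<open>0 \<le> t\<close>] by (simp add: dot_square_norm)
    also have "\<dots> < M * (sqrt (m / M) * \<epsilon>)\<^sup>2"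
      using x0 M(1) by (intro mult_strict_left_mono power_strict_mono) auto
    also have "\<dots> = m * \<epsilon>\<^sup>2" using m M by (simp add: power_mult_distrib)
    finally have "(norm (x t))\<^sup>2 < \<epsilon>\<^sup>2" using m by simp
    then show "norm (x t) < \<epsilon>" using that by (simp add: power_less_imp_less_base)
  qed
  moreover have "(x \<longlongrightarrow> 0) at_top" if sol: "closed_loop_solution N P A B E K (\<lambda>_. 0) x a" for x a
  proof -
    have lim: "((\<lambda>t. ?V (x 0) / m / (1 + c / M * t)) \<longlongrightarrow> 0) at_top"
    proof (rule tendsto_divide_0[OF tendsto_const], rule filterlim_at_top_imp_at_infinity)
      show "filterlim (\<lambda>t. 1 + c / M * t) at_top at_top"
        using c M(1) by (intro filterlim_tendsto_add_at_top[OF tendsto_const]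
            filterlim_tendsto_pos_mult_at_top[OF tendsto_const] filterlim_ident) auto
    qed
    have "((\<lambda>t. (norm (x t))\<^sup>2) \<longlongrightarrow> 0) at_top"
    proof (rule tendsto_sandwich[OF _ _ tendsto_const lim])
      show "\<forall>\<^sub>F t in at_top. (norm (x t))\<^sup>2 \<le> ?V (x 0) / m / (1 + c / M * t)"
        using eventually_ge_at_top[of 0]
      proof eventually_elim
        case (elim t)
        have pos: "0 < 1 + c / M * t" using c M(1) elim by (intro add_pos_nonneg) auto
        have "m * (norm (x t))\<^sup>2 * (1 + c / M * t) \<le> ?V (x t) * (1 + c / M * t)"
          using m(2)[of "x t"] pos by (intro mult_right_mono) (auto simp: dot_square_norm)
        also have "\<dots> \<le> ?V (x 0)" by (rule decay[OF sol elim])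
        finally show ?case using pos m(1) by (simp only: pos_le_divide_eq mult_ac)
      qed
    qed simp
    then have "((\<lambda>t. sqrt ((norm (x t))\<^sup>2)) \<longlongrightarrow> sqrt 0) at_top" by (rule tendsto_real_sqrt)
    then show ?thesis by (simp add: tendsto_norm_zero_iff)
  qed
  ultimately show ?thesis unfolding globally_asymptotically_stable_def by blast
qed

text \<open>No measurability of the output is needed: the nonnegative integral is a supremum over simple
  functions below the integrand, and the descent estimate applies to each of them.\<close>

lemma l2_norm_sq_output_le:
  fixes P :: "nat \<Rightarrow> real^'n::finite^'n"
  assumes N: "1 \<le> N" and P: "\<forall>i\<in>{1..N}. pos_def (P i)"
    and dec: "decreasing_along_active N P A B C D K c" and c: "0 < c"
    and sol: "closed_loop_solution N P A B E K (\<lambda>_. 0) x a"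
    and \<kappa>: "\<kappa> = min_quad N P (x 0) - c * integral {0..1} (\<lambda>t. x t \<bullet> x t)"
  shows "l2_norm_sq (modified_output N P C D F K (\<lambda>_. 0) x a) \<le> ennreal \<kappa>"
proof -
  define z where "z = modified_output N P C D F K (\<lambda>_. 0) x a"
  let ?f = "\<lambda>t. ennreal (z t \<bullet> z t) * indicator {0..} t"
  have cont: "continuous_on {0..1} x"
    using sol abs_continuous_on_imp_continuous_on[of 0 1 x] by (simp add: closed_loop_solution_def)
  then have int: "((\<lambda>t. c * (x t \<bullet> x t)) has_integral c * integral {0..1} (\<lambda>t. x t \<bullet> x t)) {0..1}"
    by (intro has_integral_mult_right integrable_integral integrable_continuous_real continuous_intros)
  have "integral\<^sup>N lebesgue g \<le> ennreal \<kappa>" if g: "simple_function lebesgue g" "g \<le> ?f" for g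
  proof -
    have gm: "g \<in> borel_measurable lebesgue" by (rule borel_measurable_simple_function[OF g(1)])
    define \<gamma> where "\<gamma> t = enn2real (g t)" for t
    have gle: "g t \<le> ennreal (z t \<bullet> z t)" for t
      using le_funD[OF g(2), of t] by (cases "0 \<le> t") auto
    then have g\<gamma>: "g t = ennreal (\<gamma> t)" for t
      unfolding \<gamma>_def by (metis ennreal_enn2real ennreal_less_top order_le_less_trans)
    have \<gamma>0: "0 \<le> \<gamma> t" and \<gamma>z: "\<gamma> t \<le> z t \<bullet> z t" for t
      using gle[of t] by (auto simp: \<gamma>_def enn2real_leI)
    have gneg: "g t = 0" if "t < 0" for t
      using le_funD[OF g(2), of t] that by simp
    have "finite (range \<gamma>)"
      using simple_functionD(1)[OF g(1)] unfolding \<gamma>_def by (simp flip: image_image[of enn2real g])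
    then obtain R where R: "\<And>t. \<gamma> t \<le> R"
      using bdd_above_finite unfolding bdd_above_def by (metis rangeI)
    have main: "(\<integral>\<^sup>+t. g t * indicator {0..real n} t \<partial>lebesgue) \<le> ennreal \<kappa>" if n: "1 \<le> n" for n
    proof -
      have "\<gamma> absolutely_integrable_on {0..real n}"
      proof (rule measurable_bounded_by_integrable_imp_absolutely_integrable[where g = "\<lambda>_. R"])
        show "\<gamma> \<in> borel_measurable (lebesgue_on {0..real n})"
          unfolding \<gamma>_def using gm by (intro measurable_restrict_space1) measurable
      qed (use \<gamma>0 R in auto)
      then have \<gamma>int: "\<gamma> integrable_on {0..real n}" by (rule set_lebesgue_integral_eq_integral(1))
      \<comment> \<open>The margin is kept on \<open>{0..1}\<close> only. The amount subtracted in
        \<kappa> is then the same for every window \<open>{0..real n}\<close> with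
        \<open>1 \<le> n\<close>, so \<kappa> bounds them all.\<close>
      let ?w = "\<lambda>t. if t \<in> {0..1} then c * (x t \<bullet> x t) else 0"
      have w: "(?w has_integral c * integral {0..1} (\<lambda>t. x t \<bullet> x t)) {0..real n}"
        using n int by (subst has_integral_restrict) auto
      have h: "((\<lambda>t. \<gamma> t + ?w t) has_integral
          integral {0..real n} \<gamma> + c * integral {0..1} (\<lambda>t. x t \<bullet> x t)) {0..real n}"
        by (intro has_integral_add w integrable_integral \<gamma>int)
      have "min_quad N P (x (real n)) + integral {0..real n} (\<lambda>t. \<gamma> t + ?w t) \<le> min_quad N P (x 0)"
      proof (rule min_quad_descent[OF N dec sol, where F = F])
        fix t
        show "\<gamma> t + ?w t \<le> c * (x t \<bullet> x t) + modified_output N P C D F K (\<lambda>_. 0) x a t \<bullet> modified_output N P C D F K (\<lambda>_. 0) x a t"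
        proof -
          have "?w t \<le> c * (x t \<bullet> x t)" using c by simp
          then show ?thesis using \<gamma>z[of t] unfolding z_def by linarith
        qed
      qed (use h in auto)
      then have "integral {0..real n} \<gamma> \<le> \<kappa>"
        using min_quad_nonneg[OF N P, where x = "x (real n)"] unfolding integral_unique[OF h] \<kappa> by simp
      moreover have "(\<integral>\<^sup>+t. g t * indicator {0..real n} t \<partial>lebesgue) = ennreal (integral {0..real n} \<gamma>)"
        using nn_integral_has_integral_lebesgue'[of "{0..real n}" \<gamma>, OF \<gamma>0 integrable_integral[OF \<gamma>int]]
        by (simp add: nn_integral_completion g\<gamma>)
      ultimately show ?thesis by (simp add: ennreal_leI)
    qed
    \<comment> \<open>Monotone convergence over growing windows. The successor makes every window
      contain \<open>{0..1}\<close>, and \<open>g\<close> vanishes at negative times.\<close>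
    have "integral\<^sup>N lebesgue g = (\<integral>\<^sup>+t. (SUP n. g t * indicator {0..real (Suc n)} t) \<partial>lebesgue)"
    proof (rule nn_integral_cong)
      fix t
      show "g t = (SUP n. g t * indicator {0..real (Suc n)} t)"
      proof (rule antisym)
        obtain n :: nat where "t \<le> real n" using real_arch_simple by blast
        then have eq: "g t = g t * indicator {0..real (Suc n)} t"
          using gneg[of t] by (cases "t < 0") (auto simp: indicator_def)
        show "g t \<le> (SUP n. g t * indicator {0..real (Suc n)} t)"
          by (rule ord_eq_le_trans[OF eq]) (rule SUP_upper, simp)
      qed (auto intro!: SUP_least simp: indicator_def)
    qed
    also have "\<dots> = (SUP n. \<integral>\<^sup>+t. g t * indicator {0..real (Suc n)} t \<partial>lebesgue)"
    proof (rule nn_integral_monotone_convergence_SUP)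
      show "incseq (\<lambda>n t. g t * indicator {0..real (Suc n)} t)"
        by (auto simp: incseq_def le_fun_def indicator_def)
      show "(\<lambda>t. g t * indicator {0..real (Suc n)} t) \<in> borel_measurable lebesgue" for n
        by (intro borel_measurable_times_ennreal borel_measurable_indicator gm) simp
    qed
    also have "\<dots> \<le> ennreal \<kappa>" by (intro SUP_least main) simp
    finally show ?thesis .
  qed
  then show ?thesis
    unfolding l2_norm_sq_def z_def[symmetric] nn_integral_def[of lebesgue ?f]
    by (auto intro!: SUP_least simp flip: nn_integral_eq_simple_integral)
qed

section \<open>The strict trace bound on \<open>J2\<close>\<close>

lemma trace_congruence:
  fixes E :: "real^'q::finite^'n::finite" and P :: "real^'n^'n"
  shows "trace (transpose E ** P ** E) = (\<Sum>k\<in>UNIV. (E *v axis k 1) \<bullet> (P *v (E *v axis k 1)))"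
proof -
  have "(transpose E ** P ** E) $ k $ k = (E *v axis k 1) \<bullet> (P *v (E *v axis k 1))" for k
  proof -
    have "(transpose E ** P ** E) $ k $ k = axis k 1 \<bullet> ((transpose E ** P ** E) *v axis k 1)"
      by (simp add: matrix_vector_mult_basis column_def inner_axis')
    also have "\<dots> = axis k 1 \<bullet> (transpose E *v (P *v (E *v axis k 1)))"
      by (simp only: matrix_vector_mul_assoc matrix_mul_assoc)
    finally show ?thesis by (simp only: inner_transpose_mult)
  qed
  then show ?thesis by (simp add: trace_def)
qed

text \<open>Summing over the channels, the sum of the minima of the quadratic forms at the columns
  of \<open>E0\<close> is at most the minimum of the sums, which are the traces. Strictness comes
  from a channel with nonzero column: its trajectory starts away from 0 and dissipates a positive
  amount by time 1.\<close>

lemma J2_less_Min_trace: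
  fixes P :: "nat \<Rightarrow> real^'n::finite^'n" and E0 :: "real^'q::finite^'n"
  assumes N: "1 \<le> N" and P: "\<forall>i\<in>{1..N}. pos_def (P i)"
    and dec: "decreasing_along_active N P A B C D K c" and c: "0 < c"
    and fam: "impulse_response_family N P A B E0 K xs as" and E0: "E0 \<noteq> 0"
  shows "J2 N P C D F K xs as < ennreal (Min ((\<lambda>i. trace (transpose E0 ** P i ** E0)) ` {1..N}))"
proof -
  have sol: "closed_loop_solution N P A B (\<lambda>_. E0) K (\<lambda>_. 0) (xs k) (as k)"
    and x0: "xs k 0 = E0 *v axis k 1" for k
    using fam by (auto simp: impulse_response_family_def)
  define I where "I k = integral {0..1} (\<lambda>t. xs k t \<bullet> xs k t)" for k
  define \<kappa> where "\<kappa> k = min_quad N P (xs k 0) - c * I k" for k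
  have cont: "continuous_on {0..1} (\<lambda>t. xs k t \<bullet> xs k t)" for k
    using sol[of k] abs_continuous_on_imp_continuous_on[of 0 1 "xs k"]
    by (intro continuous_intros) (simp_all add: closed_loop_solution_def)
  have I0: "0 \<le> I k" for k
    unfolding I_def by (intro integral_nonneg integrable_continuous_real cont) auto
  \<comment> \<open>\<open>ennreal\<close> truncates negative numbers, so the sum of the channel
    bounds becomes a real sum only once each is known to be nonnegative.\<close>
  have \<kappa>0: "0 \<le> \<kappa> k" for k
  proof -
    have "min_quad N P (xs k 1) + integral {0..1} (\<lambda>t. c * (xs k t \<bullet> xs k t)) \<le> min_quad N P (xs k 0)"
      by (rule min_quad_descent[OF N dec sol, where F = F])
         (auto intro!: integrable_continuous_real continuous_intros cont)
    then show ?thesis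
      using min_quad_nonneg[OF N P, where x = "xs k 1"] by (simp add: \<kappa>_def I_def)
  qed
  obtain k where k: "xs k 0 \<noteq> 0"
  proof -
    have "\<exists>k. E0 *v axis k 1 \<noteq> 0"
    proof (rule ccontr)
      assume "\<not> ?thesis"
      then have "column k E0 = 0" for k by (simp add: matrix_vector_mult_basis)
      then have "E0 = 0" by (simp add: column_def vec_eq_iff)
      with E0 show False ..
    qed
    then obtain k where "E0 *v axis k 1 \<noteq> 0" by blast
    then show thesis using that[of k] x0[of k] by simp
  qed
  have "I k \<noteq> 0"
  proof
    assume "I k = 0"
    then have "\<forall>t\<in>{0..1}. xs k t \<bullet> xs k t = 0"
      unfolding I_def using integral_eq_0_iff[OF cont] by simp
    then show False using k by auto
  qed
  then have "0 < I k" using I0[of k] by simp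
  have "J2 N P C D F K xs as \<le> (\<Sum>k\<in>UNIV. ennreal (\<kappa> k))"
    unfolding J2_def
    by (intro sum_mono l2_norm_sq_output_le[OF N P dec c sol]) (auto simp: \<kappa>_def I_def)
  also have "\<dots> = ennreal (\<Sum>k\<in>UNIV. \<kappa> k)" by (rule sum_ennreal) (rule \<kappa>0)
  also have "\<dots> < ennreal (Min ((\<lambda>i. trace (transpose E0 ** P i ** E0)) ` {1..N}))"
  proof (subst ennreal_less_iff)
    show "0 \<le> (\<Sum>k\<in>UNIV. \<kappa> k)" by (intro sum_nonneg \<kappa>0)
    have "(\<Sum>k\<in>UNIV. \<kappa> k) < (\<Sum>k\<in>UNIV. min_quad N P (xs k 0))"
    proof (rule sum_strict_mono_ex1)
      show "\<forall>k\<in>UNIV. \<kappa> k \<le> min_quad N P (xs k 0)" using c I0 by (simp add: \<kappa>_def)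
      show "\<exists>k\<in>UNIV. \<kappa> k < min_quad N P (xs k 0)"
        using c \<open>0 < I k\<close> by (intro bexI[of _ k]) (simp_all add: \<kappa>_def)
    qed simp
    also have "\<dots> \<le> Min ((\<lambda>i. trace (transpose E0 ** P i ** E0)) ` {1..N})"
      using N by (subst Min_ge_iff) (auto simp: trace_congruence x0 intro!: sum_mono min_quad_le)
    finally show "(\<Sum>k\<in>UNIV. \<kappa> k) < Min ((\<lambda>i. trace (transpose E0 ** P i ** E0)) ` {1..N})" .
  qed
  finally show ?thesis .
qed

text \<open>The margin is extracted with the Metzler term still present, since the hypothesis gives
  negativity on the whole sphere only for that full form. The term is dropped afterwards, at active
  states.\<close>

lemma lyapunov_metzler_imp_decreasing:
  fixes P :: "nat \<Rightarrow> real^'n::finite^'n" and B :: "nat \<Rightarrow> real^'m::finite^'n" and C :: "nat \<Rightarrow> real^'n^'p::finite"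
  assumes N: "1 \<le> N" and \<pi>: "\<pi> \<in> metzler_plus N"
    and lm: "\<And>i x. i \<in> {1..N} \<Longrightarrow> x \<noteq> 0 \<Longrightarrow>
      vdot (P i) x ((A i + B i ** K i) *v x) + (\<Sum>j\<in>{1..N}. \<pi> j i * (x \<bullet> (P j *v x)))
        + ((C i + D i ** K i) *v x) \<bullet> ((C i + D i ** K i) *v x) < 0"
  shows "\<exists>c>0. decreasing_along_active N P A B C D K c"
proof -
  define \<phi> where "\<phi> i x = vdot (P i) x ((A i + B i ** K i) *v x) + (\<Sum>j\<in>{1..N}. \<pi> j i * (x \<bullet> (P j *v x)))
        + ((C i + D i ** K i) *v x) \<bullet> ((C i + D i ** K i) *v x)" for i x
  have "\<exists>c>0. \<forall>i\<in>{1..N}. \<forall>x. \<phi> i x \<le> - c * (x \<bullet> x)"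
  proof (rule finite_uniform_margin)
    fix i assume i: "i \<in> {1..N}"
    show "\<exists>c>0. \<forall>x. \<phi> i x \<le> - c * (x \<bullet> x)"
    proof (rule homogeneous_negative_margin)
      show "continuous_on UNIV (\<phi> i)"
        unfolding \<phi>_def vdot_def matrix_vector_mul_assoc by (intro continuous_intros)
      show "\<phi> i (r *\<^sub>R x) = r\<^sup>2 * \<phi> i x" for r x
        by (simp add: \<phi>_def vdot_def matrix_vector_mult_scaleR power2_eq_square sum_distrib_left algebra_simps)
    qed (use lm i in \<open>simp add: \<phi>_def\<close>)
  qed simp
  then obtain c where c: "0 < c" "\<And>i x. i \<in> {1..N} \<Longrightarrow> \<phi> i x \<le> - c * (x \<bullet> x)" by blast
  have "decreasing_along_active N P A B C D K c"
    unfolding decreasing_along_active_def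
  proof (intro allI ballI)
    fix x i assume act: "i \<in> active N P x"
    then have i: "i \<in> {1..N}" using active_subset by blast
    \<comment> \<open>The zero column sum permits subtracting \<open>x \<bullet> (P i *v x)\<close>
      from every form. The diagonal term, the only one with a coefficient that may be negative, then
      cancels, and the others are nonnegative.\<close>
    have "0 = (\<Sum>j\<in>{1..N}. \<pi> j i) * (x \<bullet> (P i *v x))" using \<pi> i by (simp add: metzler_plus_def)
    also have "\<dots> = (\<Sum>j\<in>{1..N}. \<pi> j i * (x \<bullet> (P i *v x)))" by (rule sum_distrib_right)
    also have "\<dots> \<le> (\<Sum>j\<in>{1..N}. \<pi> j i * (x \<bullet> (P j *v x)))"
    proof (rule sum_mono)
      fix j assume j: "j \<in> {1..N}"
      show "\<pi> j i * (x \<bullet> (P i *v x)) \<le> \<pi> j i * (x \<bullet> (P j *v x))"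
      proof (cases "j = i")
        case False
        then have "0 < \<pi> j i" using \<pi> i j by (simp add: metzler_plus_def)
        then show ?thesis using active_minimal[OF N act j] by simp
      qed simp
    qed
    finally show "vdot (P i) x ((A i + B i ** K i) *v x)
       \<le> - c * (x \<bullet> x) - ((C i + D i ** K i) *v x) \<bullet> ((C i + D i ** K i) *v x)"
      using c(2)[OF i, of x] unfolding \<phi>_def by linarith
  qed
  with c(1) show ?thesis by blast
qed

theorem theorem3:
  fixes N :: nat
    and T :: "nat \<Rightarrow> nat"
    and A :: "nat \<Rightarrow> real^'n^'n" and B :: "nat \<Rightarrow> real^'m^'n"
    and C :: "nat \<Rightarrow> real^'n^'p" and D :: "nat \<Rightarrow> real^'m^'p"
    and E :: "nat \<Rightarrow> real^'q^'n" and F :: "nat \<Rightarrow> real^'q^'p"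
    and X Xd W :: "nat \<Rightarrow> ('n, nat) imat" and U :: "nat \<Rightarrow> ('m, nat) imat"
    and \<Phi> :: "nat \<Rightarrow> ('n + nat, 'n + nat) imat"
    and P Y :: "nat \<Rightarrow> real^'n^'n" and L K :: "nat \<Rightarrow> real^'n^'m"
    and \<alpha> :: "nat \<Rightarrow> real" and \<pi> :: "nat \<Rightarrow> nat \<Rightarrow> real"
  assumes "1 \<le> N"
    and "\<And>i. i \<in> {1..N} \<Longrightarrow> symmetric_on (data_index (T i)) (\<Phi> i)"
    and "\<And>i. i \<in> {1..N} \<Longrightarrow> pos_def_on {..<T i} (\<lambda>k l. - \<Phi> i (Inr k) (Inr l))"
    and "\<And>i. i \<in> {1..N} \<Longrightarrow> W i \<in> noise_set (T i) (\<Phi> i)"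
    and "\<And>i r k. i \<in> {1..N} \<Longrightarrow> k < T i \<Longrightarrow>
           Xd i r k = imat_mult UNIV (ent (A i)) (X i) r k
                      + imat_mult UNIV (ent (B i)) (U i) r k + W i r k"
    and "\<And>i. i \<in> {1..N} \<Longrightarrow> pos_def (P i)"
    and "\<And>i. i \<in> {1..N} \<Longrightarrow> 0 \<le> \<alpha> i"
    and "\<And>i. i \<in> {1..N} \<Longrightarrow> pos_def (Y i)"
    and "\<pi> \<in> metzler_plus N"
    and "\<And>i. i \<in> {1..N} \<Longrightarrow>
           pos_semidef_on (lmi_index N i)
             (\<lambda>r c. lmi_block N \<pi> P (L i) (Y i) i r c
                    - \<alpha> i * imat_mult (data_index (T i))
                              (imat_mult (data_index (T i)) (Gamma_block (Xd i) (X i) (U i)) (\<Phi> i))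
                              (imat_transpose (Gamma_block (Xd i) (X i) (U i))) r c)"
    and "\<And>i. i \<in> {1..N} \<Longrightarrow> pos_def_on UNIV (perf_block (C i) (D i) (P i) (L i) (Y i))"
    and "\<And>i. i \<in> {1..N} \<Longrightarrow> K i = L i ** P i"
  shows "globally_asymptotically_stable {x. \<exists>a. closed_loop_solution N P A B E K (\<lambda>_. 0) x a} \<and>
    (\<forall>E0 xs as. (\<forall>i\<in>{1..N}. E i = E0) \<and> (\<forall>i\<in>{1..N}. F i = 0) \<and> E0 \<noteq> 0 \<and>
       impulse_response_family N P A B E0 K xs as \<longrightarrow>
       J2 N P C D F K xs as < ennreal (Min ((\<lambda>i. trace (transpose E0 ** P i ** E0)) ` {1..N})))"
proof -
  have "vdot (P i) x ((A i + B i ** K i) *v x) + (\<Sum>j\<in>{1..N}. \<pi> j i * (x \<bullet> (P j *v x)))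
        + ((C i + D i ** K i) *v x) \<bullet> ((C i + D i ** K i) *v x) < 0"
    if i: "i \<in> {1..N}" and "x \<noteq> 0" for i x
    using lyapunov_metzler_inequality[OF i assms(4)[OF i] assms(5)[OF i] assms(6) assms(7)[OF i] assms(9) assms(10)[OF i], of x]
      perf_block_bound[OF assms(6)[OF i] assms(11)[OF i] \<open>x \<noteq> 0\<close>]
    unfolding assms(12)[OF i] by linarith
  then obtain c where c: "0 < c" and dec: "decreasing_along_active N P A B C D K c"
    using lyapunov_metzler_imp_decreasing[OF assms(1,9)] by blast
  have Pdef: "\<forall>i\<in>{1..N}. pos_def (P i)" using assms(6) by blast
  show ?thesis
    using closed_loop_globally_asymptotically_stable[OF assms(1) Pdef dec c]
      J2_less_Min_trace[OF assms(1) Pdef dec c] by blast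
qed

end
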